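(* Let $V:\mathbb{R}^2\to\mathbb{R}$ be a function such that: (1) $V(x)\to+\infty$ as $|x|\to\infty$; (2) $V$ is of class $C^1$, $V\ge 1$, and there exist positive constants $\rho_0$ and $C_1$ such that $|\nabla V(x)| \le C_1 V(x)^{1-\rho_0}$ for all $x\in\mathbb{R}^2$; (3) for any $\delta\in]0,1[$ there exist positive constants $A_\delta$ and $\lambda_\delta$ such that $$1 < \frac{A(B_V(\lambda))}{A(B_V(\delta\lambda))} \le A_\delta \qquad \text{for all } \lambda\ge\lambda_\delta .$$ Let $H_V:=-\Delta+V(x)$ on $L^2(\mathbb{R}^2)$. Fix $\delta\in(0,1)$. Then there exist a positive constant $C_\delta$ (depending only on the constants appearing in the assumptions on $V$) and a constant $\lambda_\delta$ such that, for any eigenpair $(u,\lambda)$ of $H_V$ (with $u\neq0$ real-valued, $H_Vu=\lambda u$) with $\lambda \ge \lambda_\delta$, the length of $N(u) \cap B_V(\delta\lambda)$ is larger than $C_\delta\, \lambda^{\frac12}\, A(B_V(\lambda))$.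
   Context: $N(u)$ is the nodal set of $u$, i.e. the closure of $\{u=0\}$. For $\mu>0$, $B_V(\mu) := \{ x \in \mathbb{R}^2 \mid V(x) < \mu \}$. $A(\Omega)$ denotes the area of $\Omega$. Length means one-dimensional Hausdorff measure. *)

theory Defs
  imports "HOL-Analysis.Analysis"
begin

definition partial_deriv :: "2 \<Rightarrow> (real^2 \<Rightarrow> real) \<Rightarrow> real^2 \<Rightarrow> real" where
  "partial_deriv i f x = frechet_derivative f (at x) (axis i 1)"

definition gradient :: "(real^2 \<Rightarrow> real) \<Rightarrow> real^2 \<Rightarrow> real^2" where
  "gradient f x = (\<chi> i. partial_deriv i f x)"

definition laplacian :: "(real^2 \<Rightarrow> real) \<Rightarrow> real^2 \<Rightarrow> real" where
  "laplacian f x = (\<Sum>i\<in>UNIV. partial_deriv i (partial_deriv i f) x)"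

primrec Ck_fun :: "nat \<Rightarrow> (real^2 \<Rightarrow> real) \<Rightarrow> bool" where
  "Ck_fun 0 f \<longleftrightarrow> continuous_on UNIV f"
| "Ck_fun (Suc k) f \<longleftrightarrow> (\<forall>x. f differentiable (at x)) \<and> (\<forall>i. Ck_fun k (partial_deriv i f))"

definition test_function :: "(real^2 \<Rightarrow> real) \<Rightarrow> bool" where
  "test_function \<phi> \<longleftrightarrow> (\<forall>k. Ck_fun k \<phi>) \<and> compact (closure {x. \<phi> x \<noteq> 0})"

definition square_integrable :: "(real^2 \<Rightarrow> real) \<Rightarrow> bool" where
  "square_integrable u \<longleftrightarrow>
     u \<in> borel_measurable lebesgue \<and> integrable lebesgue (\<lambda>x. (u x)\<^sup>2)"

text \<open>
  The graph of \<open>H\<^sub>V = - \<Delta> + V\<close> on (real) \<open>L\<^sup>2\<close>: \<open>u\<close> lies in the domain and \<open>H\<^sub>V u = f\<close> iff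
  \<open>u\<close> and \<open>f\<close> are square-integrable and \<open>- \<Delta> u + V u = f\<close> as distributions. This is the adjoint
  of \<open>- \<Delta> + V\<close> on test functions. For continuous \<open>V\<close> bounded below, \<open>- \<Delta> + V\<close> is essentially
  self-adjoint on test functions, so this is the unique self-adjoint realisation.
\<close>

definition schroedinger_graph ::
  "(real^2 \<Rightarrow> real) \<Rightarrow> (real^2 \<Rightarrow> real) \<Rightarrow> (real^2 \<Rightarrow> real) \<Rightarrow> bool" where
  "schroedinger_graph V u f \<longleftrightarrow>
     square_integrable u \<and> square_integrable f \<and>
     (\<forall>\<phi>. test_function \<phi> \<longrightarrow>
        (\<integral>x. u x * (- laplacian \<phi> x + V x * \<phi> x) \<partial>lebesgue) = (\<integral>x. f x * \<phi> x \<partial>lebesgue))"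

text \<open>
  An element of \<open>L\<^sup>2\<close> is a class modulo null sets, whereas its nodal set depends on pointwise
  values. As usual, an eigenfunction is identified with its (unique) continuous representative,
  which exists by elliptic regularity. No differentiability of \<open>u\<close> is assumed.
\<close>

definition eigenpair :: "(real^2 \<Rightarrow> real) \<Rightarrow> (real^2 \<Rightarrow> real) \<Rightarrow> real \<Rightarrow> bool" where
  "eigenpair V u E \<longleftrightarrow>
     continuous_on UNIV u \<and> \<not> (AE x in lebesgue. u x = 0) \<and>
     schroedinger_graph V u (\<lambda>x. E * u x)"

definition nodal_set :: "(real^2 \<Rightarrow> real) \<Rightarrow> (real^2) set" where
  "nodal_set u = closure {x. u x = 0}"

definition sublevel :: "(real^2 \<Rightarrow> real) \<Rightarrow> real \<Rightarrow> (real^2) set" where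
  "sublevel V \<mu> = {x. V x < \<mu>}"

definition area :: "(real^2) set \<Rightarrow> real" where
  "area S = measure lebesgue S"

text \<open>
  One-dimensional Hausdorff (outer) measure. The boundedness condition is needed because
  \<open>diameter\<close> is an unspecified real number on unbounded sets.
\<close>

definition hausdorff1_pre :: "real \<Rightarrow> 'a::metric_space set \<Rightarrow> ennreal" where
  "hausdorff1_pre \<epsilon> S =
     (INF U \<in> {U :: nat \<Rightarrow> 'a set. S \<subseteq> (\<Union>n. U n) \<and> (\<forall>n. bounded (U n) \<and> diameter (U n) \<le> \<epsilon>)}.
        (\<Sum>n. ennreal (diameter (U n))))"

definition hausdorff1 :: "'a::metric_space set \<Rightarrow> ennreal" where
  "hausdorff1 S = (SUP \<epsilon> \<in> {0<..}. hausdorff1_pre \<epsilon> S)"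

text \<open>
  The assumptions on \<open>V\<close>, with all constants explicit, so that dependence on the constants alone
  can be expressed: \<open>Ac \<delta>\<close> and \<open>\<Lambda> \<delta>\<close> are the constants \<open>A\<^sub>\<delta>\<close> and \<open>\<lambda>\<^sub>\<delta>\<close> of the doubling condition.
\<close>

definition admissible_potential ::
  "real \<Rightarrow> real \<Rightarrow> (real \<Rightarrow> real) \<Rightarrow> (real \<Rightarrow> real) \<Rightarrow> (real^2 \<Rightarrow> real) \<Rightarrow> bool" where
  "admissible_potential \<rho>\<^sub>0 C\<^sub>1 Ac \<Lambda> V \<longleftrightarrow>
     filterlim V at_top at_infinity \<and>
     Ck_fun 1 V \<and> (\<forall>x. 1 \<le> V x) \<and>
     0 < \<rho>\<^sub>0 \<and> 0 < C\<^sub>1 \<and> (\<forall>x. norm (gradient V x) \<le> C\<^sub>1 * V x powr (1 - \<rho>\<^sub>0)) \<and>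
     (\<forall>\<delta>. 0 < \<delta> \<and> \<delta> < 1 \<longrightarrow>
        0 < Ac \<delta> \<and> 0 < \<Lambda> \<delta> \<and>
        (\<forall>t \<ge> \<Lambda> \<delta>. 1 < area (sublevel V t) / area (sublevel V (\<delta> * t)) \<and>
                    area (sublevel V t) / area (sublevel V (\<delta> * t)) \<le> Ac \<delta>))"

end

theory Submission
  imports Defs
begin

text \<open>
  On a disc of radius of order \<open>E\<^sup>-\<^sup>1\<^sup>/\<^sup>2\<close> inside \<open>{V < \<delta> E}\<close> an eigenfunction \<open>u\<close> has a zero, because a smooth
  bump \<open>\<phi>\<close> with \<open>- \<Delta> \<phi> \<le> 324 r\<^sup>-\<^sup>2 \<phi>\<close> cannot be a test function for a positive solution. If \<open>u y = 0\<close>,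
  then every circle about \<open>y\<close> of radius \<open>s \<le> E\<^sup>-\<^sup>1\<^sup>/\<^sup>2\<close> meets the zero set: otherwise \<open>u\<close> has a sign on the
  circle and the maximum principle, valid on such small discs, gives \<open>u y \<noteq> 0\<close>. As \<open>x \<mapsto> |x - y|\<close> is
  1-Lipschitz, the nodal set has length at least \<open>E\<^sup>-\<^sup>1\<^sup>/\<^sup>2\<close> in the disc. Finally, \<open>ln V\<close> is Lipschitz, so
  discs centred in \<open>{V < \<delta> E / 2}\<close> stay in \<open>{V < \<delta> E}\<close>, and by the Vitali covering lemma and the doubling
  condition there are of order \<open>E A(B\<^sub>V(E))\<close> disjoint ones.
\<close>

subsection \<open>Smooth bump functions\<close>

lemma partial_deriv_eq:
  "(f has_derivative f') (at x) \<Longrightarrow> partial_deriv i f x = f' (axis i 1)"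
  unfolding partial_deriv_def using frechet_derivative_at by metis

lemma Ck_fun_Suc_imp: "Ck_fun (Suc k) f \<Longrightarrow> Ck_fun k f"
proof (induction k arbitrary: f)
  case 0
  then show ?case
    by (auto intro!: differentiable_imp_continuous_on simp: differentiable_on_def
          intro: differentiable_at_withinI)
next
  case (Suc k)
  then show ?case by (metis Ck_fun.simps(2))
qed

lemma Ck_fun_const: "Ck_fun k (\<lambda>x. c)"
proof (induction k arbitrary: c)
  case (Suc k)
  have "partial_deriv i (\<lambda>x. c) = (\<lambda>x. 0)" for i
    by (rule ext, subst partial_deriv_eq[OF has_derivative_const]) simp
  then show ?case using Suc by simp
qed simp

lemma Ck_fun_nth: "Ck_fun k (\<lambda>x. x $ i)"
proof (cases k)
  case (Suc l)
  have D: "((\<lambda>x::real^2. x $ i) has_derivative (\<lambda>h. h $ i)) (at x)" for x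
    by (intro bounded_linear_imp_has_derivative bounded_linear_vec_nth)
  have "partial_deriv j (\<lambda>x. x $ i) = (\<lambda>x. axis j 1 $ i)" for j
    by (rule ext, subst partial_deriv_eq[OF D]) simp
  moreover have "(\<lambda>x::real^2. x $ i) differentiable at x" for x
    using D differentiable_def by blast
  ultimately show ?thesis using Suc Ck_fun_const by simp
qed (auto intro: continuous_intros)

lemma partial_deriv_add:
  assumes "f differentiable at x" "g differentiable at x"
  shows "partial_deriv i (\<lambda>x. f x + g x) x = partial_deriv i f x + partial_deriv i g x"
  unfolding partial_deriv_def
  using partial_deriv_eq[OF has_derivative_add[OF assms[unfolded frechet_derivative_works]]]
  by (simp add: partial_deriv_def)

lemma partial_deriv_mult:
  assumes "f differentiable at x" "g differentiable at x"
  shows "partial_deriv i (\<lambda>x. f x * g x) x = f x * partial_deriv i g x + partial_deriv i f x * g x"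
  unfolding partial_deriv_def
  using partial_deriv_eq[OF has_derivative_mult[OF assms[unfolded frechet_derivative_works]]]
  by (simp add: partial_deriv_def)

lemma Ck_fun_add: "Ck_fun k f \<Longrightarrow> Ck_fun k g \<Longrightarrow> Ck_fun k (\<lambda>x. f x + g x)"
proof (induction k arbitrary: f g)
  case (Suc k)
  have "partial_deriv i (\<lambda>x. f x + g x) = (\<lambda>x. partial_deriv i f x + partial_deriv i g x)" for i
    using Suc.prems by (intro ext partial_deriv_add) auto
  then show ?case using Suc by (simp add: differentiable_add)
qed (auto intro: continuous_intros)

lemma Ck_fun_mult: "Ck_fun k f \<Longrightarrow> Ck_fun k g \<Longrightarrow> Ck_fun k (\<lambda>x. f x * g x)"
proof (induction k arbitrary: f g)
  case (Suc k)
  have "partial_deriv i (\<lambda>x. f x * g x)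
      = (\<lambda>x. f x * partial_deriv i g x + partial_deriv i f x * g x)" for i
    using Suc.prems by (intro ext partial_deriv_mult) auto
  moreover have "Ck_fun k f" "Ck_fun k g" using Suc.prems Ck_fun_Suc_imp by blast+
  moreover have "Ck_fun k (partial_deriv i f)" "Ck_fun k (partial_deriv i g)" for i
    using Suc.prems by simp_all
  ultimately show ?case using Suc.prems
    by (simp add: differentiable_mult Ck_fun_add Suc.IH)
qed (auto intro: continuous_intros)

text \<open>The classical function \<open>exp (- 1 / t)\<close>, extended by zero, has derivatives
  that are combinations of its quotients by powers of \<open>t\<close>. Indexing by the power gives
  a family closed under differentiation.\<close>

definition flat :: "nat \<Rightarrow> real \<Rightarrow> real" where
  "flat n t = (if 0 < t then exp (- (1 / t)) / t ^ n else 0)"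

lemma flat_nonneg: "0 \<le> flat n t"
  by (simp add: flat_def)

text \<open>The exponential series at \<open>1 / t\<close> dominates its term of order
  \<open>n + 1\<close>. The resulting linear bound makes every \<open>flat n\<close> tend to 0 at
  the origin, whatever the power in the denominator.\<close>

lemma flat_le:
  assumes "0 < t"
  shows "flat n t \<le> fact (Suc n) * t"
proof -
  obtain r where "exp (1/t) = (\<Sum>m<n + 2. (1/t) ^ m / fact m) + exp r / fact (n + 2) * (1/t) ^ (n + 2)"
    using Maclaurin_exp_le by blast
  moreover have "(1/t) ^ Suc n / fact (Suc n) \<le> (\<Sum>m<n + 2. (1/t) ^ m / fact m)"
    using assms by (intro member_le_sum) auto
  moreover have "0 \<le> exp r / fact (n + 2) * (1/t) ^ (n + 2)"
    using assms by simp
  ultimately have "(1/t) ^ Suc n / fact (Suc n) \<le> exp (1/t)" by linarith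
  then have "1 / t ^ n \<le> exp (1/t) * (fact (Suc n) * t)"
    using assms by (simp add: field_simps del: fact_Suc)
  then show ?thesis
    using assms by (simp add: flat_def exp_minus field_simps del: fact_Suc)
qed

text \<open>The quotient rule applies for positive \<open>t\<close>. At 0 the difference quotient is
  \<open>flat (n + 1) h\<close> for positive \<open>h\<close> and 0 for negative \<open>h\<close>,
  hence tends to 0 by \<open>flat_le\<close>.\<close>

lemma flat_has_derivative:
  "(flat n has_real_derivative (flat (n + 2) t - n * flat (n + 1) t)) (at t)"
proof -
  consider "t < 0" | "t = 0" | "0 < t" by linarith
  then show ?thesis
  proof cases
    case 1
    have "((\<lambda>t. 0) has_real_derivative 0) (at t)" by simp
    then have "(flat n has_real_derivative 0) (at t)"
      by (rule has_field_derivative_transform_within_open[where S="{..<0}"])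
        (use 1 in \<open>auto simp: flat_def\<close>)
    then show ?thesis using 1 by (simp add: flat_def)
  next
    case 2
    have "(flat n has_real_derivative 0) (at 0)"
      unfolding DERIV_def
    proof (rule Lim_null_comparison)
      show "\<forall>\<^sub>F h in at 0. norm ((flat n (0 + h) - flat n 0) / h) \<le> fact (n + 2) * \<bar>h\<bar>"
      proof (rule always_eventually, rule allI)
        fix h :: real
        show "norm ((flat n (0 + h) - flat n 0) / h) \<le> fact (n + 2) * \<bar>h\<bar>"
        proof (cases "0 < h")
          case True
          have "norm ((flat n (0 + h) - flat n 0) / h) = flat (n + 1) h"
            using True by (simp add: flat_def)
          then show ?thesis using flat_le[OF True, of "n+1"] True by simp
        qed (simp add: flat_def mult_nonneg_nonpos del: fact_Suc)
      qed
      show "((\<lambda>h. fact (n + 2) * \<bar>h\<bar>) \<longlongrightarrow> 0) (at (0::real))"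
        by (intro tendsto_mult_right_zero tendsto_rabs_zero tendsto_ident_at)
    qed
    then show ?thesis using 2 by (simp add: flat_def)
  next
    case 3
    have D1: "((\<lambda>t. exp (- (1 / t))) has_real_derivative exp (- (1 / t)) * (1 / t\<^sup>2)) (at t)"
      using 3 by (auto intro!: derivative_eq_intros simp: power2_eq_square)
    have D2: "((\<lambda>t. t ^ n) has_real_derivative n * t ^ (n - 1)) (at t)"
      by (auto intro!: derivative_eq_intros)
    have "(exp (- (1 / t)) * (1 / t\<^sup>2) * t ^ n - exp (- (1 / t)) * (n * t ^ (n - 1))) / (t ^ n * t ^ n)
        = flat (n + 2) t - n * flat (n + 1) t"
      using 3 by (cases n) (simp_all add: flat_def divide_simps power2_eq_square, simp add: algebra_simps)
    with DERIV_divide[OF D1 D2] have "((\<lambda>t. exp (- (1 / t)) / t ^ n) has_real_derivative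
      (flat (n + 2) t - n * flat (n + 1) t)) (at t)"
      using 3 by simp
    then show ?thesis
      by (rule has_field_derivative_transform_within_open[where S="{0<..}"])
        (use 3 in \<open>auto simp: flat_def\<close>)
  qed
qed

text \<open>For \<open>n = 0\<close> and positive \<open>r\<close> this is the standard smooth bump
  on the disc of radius \<open>r\<close> about \<open>z\<close>; the other indices arise from
  differentiating it.\<close>

definition bump :: "nat \<Rightarrow> real^2 \<Rightarrow> real \<Rightarrow> real^2 \<Rightarrow> real" where
  "bump n z r x = flat n (1 - ((x - z) \<bullet> (x - z)) / r\<^sup>2)"

lemma bump_has_derivative:
  "(bump n z r has_derivative
     (\<lambda>h. (bump (n + 2) z r x - n * bump (n + 1) z r x) * (- (2 / r\<^sup>2) * ((x - z) \<bullet> h)))) (at x)"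
proof -
  have "((\<lambda>x. 1 - c * ((x - z) \<bullet> (x - z))) has_derivative
      (\<lambda>h. - (2 * c) * ((x - z) \<bullet> h))) (at x)" for c
    by (auto intro!: derivative_eq_intros simp: inner_commute)
  from this[of "1 / r\<^sup>2"] have "((\<lambda>x. 1 - ((x - z) \<bullet> (x - z)) / r\<^sup>2) has_derivative
      (\<lambda>h. - (2 / r\<^sup>2) * ((x - z) \<bullet> h))) (at x)"
    by simp
  from has_derivative_compose[OF this flat_has_derivative[of n, THEN has_field_derivative_imp_has_derivative]]
  show ?thesis by (simp add: bump_def[abs_def])
qed

text \<open>Differences are written as sums with negated terms so that the closure rules for
  constants, coordinates, sums and products apply directly.\<close>

lemma partial_deriv_bump:
  "partial_deriv i (bump n z r) =
   (\<lambda>x. (bump (n + 2) z r x + (- n) * bump (n + 1) z r x) * (- (2 / r\<^sup>2) * (x $ i + (- z $ i))))"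
  by (rule ext, subst partial_deriv_eq[OF bump_has_derivative])
    (simp add: inner_axis)

text \<open>Partial derivatives of a bump are combinations of bumps of higher index with polynomial
  coefficients, so the induction must range over all \<open>n\<close>.\<close>

lemma Ck_fun_bump: "Ck_fun k (bump n z r)"
proof (induction k arbitrary: n)
  case 0
  show ?case
    using bump_has_derivative has_derivative_continuous
    by (auto simp: continuous_on_eq_continuous_at, blast)
next
  case (Suc k)
  show ?case
    unfolding Ck_fun.simps partial_deriv_bump
  proof (intro conjI allI)
    show "bump n z r differentiable at x" for x
      using bump_has_derivative differentiable_def by blast
  qed (intro Ck_fun_mult Ck_fun_add Ck_fun_const Ck_fun_nth Suc)
qed

lemma bump_eq_0:
  assumes "0 < r" "x \<notin> ball z r"
  shows "bump n z r x = 0"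
proof -
  have "r\<^sup>2 \<le> (norm (x - z))\<^sup>2"
    using assms by (intro power_mono) (auto simp: dist_norm norm_minus_commute)
  then show ?thesis
    using assms by (simp add: bump_def flat_def power2_norm_eq_inner divide_simps)
qed

lemma bump_pos:
  assumes "x \<in> ball z r"
  shows "0 < bump n z r x"
proof -
  have r: "0 < r" using assms zero_le_dist[of z x] by (simp del: zero_le_dist)
  have "(norm (x - z))\<^sup>2 < r\<^sup>2"
    using assms by (intro power_strict_mono) (auto simp: dist_norm norm_minus_commute)
  then show ?thesis
    using r by (simp add: bump_def flat_def power2_norm_eq_inner divide_simps)
qed

lemma bump_nonneg: "0 \<le> bump n z r x"
  by (simp add: bump_def flat_nonneg)

lemma test_function_bump:
  assumes "0 < r"
  shows "test_function (bump n z r)"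
proof -
  have "{x. bump n z r x \<noteq> 0} \<subseteq> cball z r"
  proof
    fix x assume "x \<in> {x. bump n z r x \<noteq> 0}"
    then have "x \<in> ball z r" using bump_eq_0[OF assms] by blast
    then show "x \<in> cball z r" by simp
  qed
  then have "bounded {x. bump n z r x \<noteq> 0}"
    using bounded_cball bounded_subset by blast
  then show ?thesis
    by (simp add: test_function_def Ck_fun_bump compact_closure)
qed

lemma laplacian_bump:
  "laplacian (bump 0 z r) x =
   4 / r\<^sup>2 * ((x - z) \<bullet> (x - z) / r\<^sup>2 * (bump 4 z r x - 2 * bump 3 z r x) - bump 2 z r x)"
proof -
  have 1: "partial_deriv i (bump 0 z r) = (\<lambda>x. bump 2 z r x * (- (2 / r\<^sup>2) * (x $ i + (- z $ i))))" for i
    unfolding partial_deriv_bump by (simp add: numeral_2_eq_2)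
  have B: "(bump 2 z r has_derivative
      (\<lambda>h. (bump 4 z r x - 2 * bump 3 z r x) * (- (2 / r\<^sup>2) * ((x - z) \<bullet> h)))) (at x)"
    using bump_has_derivative[of 2 z r x] by simp
  have "((\<lambda>x. c * (x $ i + (- z $ i))) has_derivative (\<lambda>h. c * (h $ i))) (at x)" for i c
    by (auto intro!: derivative_eq_intros bounded_linear_imp_has_derivative bounded_linear_vec_nth)
  note D = has_derivative_mult[OF B this]
  have 2: "partial_deriv i (partial_deriv i (bump 0 z r)) x =
    - (2 / r\<^sup>2) * bump 2 z r x + (4 / r\<^sup>2 / r\<^sup>2) * (bump 4 z r x - 2 * bump 3 z r x) * ((x - z) $ i * (x - z) $ i)" for i
    unfolding 1 by (subst partial_deriv_eq[OF D]) (simp add: inner_axis divide_inverse algebra_simps)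
  show ?thesis
    unfolding laplacian_def 2 inner_vec_def sum_2
    by (simp add: add_divide_distrib divide_inverse algebra_simps)
qed

text \<open>With \<open>s = 1 - |x - z|\<^sup>2 / r\<^sup>2\<close> the inequality reduces to \<open>3 s - 1 - s\<^sup>2 \<le> 81 s\<^sup>4\<close>.\<close>

lemma laplacian_bump_ge:
  assumes "0 < r"
  shows "- laplacian (bump 0 z r) x \<le> 324 / r\<^sup>2 * bump 0 z r x"
proof -
  define s where "s = 1 - ((x - z) \<bullet> (x - z)) / r\<^sup>2"
  have s1: "s \<le> 1" by (simp add: s_def)
  have b: "bump n z r x = flat n s" for n by (simp add: bump_def s_def)
  have key: "flat 2 s - (1 - s) * (flat 4 s - 2 * flat 3 s) \<le> 81 * flat 0 s"
  proof (cases "0 < s")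
    case True
    \<comment> \<open>For \<open>s\<close> at most 1/3 the left side is not positive. Otherwise
      \<open>81 * s ^ 4\<close> is at least 1, while \<open>(1 - s) * (2 - s) \<ge> 0\<close> bounds
      the left side by 1.\<close>
    have "3 * s - 1 - s\<^sup>2 \<le> 81 * s ^ 4"
    proof (cases "s \<le> 1/3")
      case True
      have "0 \<le> s\<^sup>2" "0 \<le> 81 * s ^ 4" by auto
      then show ?thesis using True by linarith
    next
      case False
      have "(1/3) ^ 4 \<le> s ^ 4" using False by (intro power_mono) auto
      moreover have "0 \<le> (1 - s) * (2 - s)" using s1 by simp
      ultimately show ?thesis by (simp add: algebra_simps power2_eq_square power4_eq_xxxx)
    qed
    then have "exp (- (1/s)) * (3 * s - 1 - s\<^sup>2) / s ^ 4 \<le> exp (- (1/s)) * (81 * s ^ 4) / s ^ 4"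
      using True by (intro divide_right_mono mult_left_mono) auto
    also have "exp (- (1/s)) * (3 * s - 1 - s\<^sup>2) / s ^ 4 = flat 2 s - (1 - s) * (flat 4 s - 2 * flat 3 s)"
      using True by (simp add: flat_def field_simps power2_eq_square power3_eq_cube power4_eq_xxxx)
    finally show ?thesis using True by (simp add: flat_def)
  qed (simp add: flat_def)
  have e: "((x - z) \<bullet> (x - z)) / r\<^sup>2 = 1 - s" by (simp add: s_def)
  have "- laplacian (bump 0 z r) x = 4 / r\<^sup>2 * (flat 2 s - (1 - s) * (flat 4 s - 2 * flat 3 s))"
    unfolding laplacian_bump b e by (simp add: algebra_simps)
  also have "\<dots> \<le> 4 / r\<^sup>2 * (81 * flat 0 s)"
    using key by (intro mult_left_mono) auto
  finally show ?thesis by (simp add: b)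
qed

subsection \<open>Testing the equation with bump functions\<close>

lemma borel_measurable_lebesgue_continuous:
  fixes f :: "'a::euclidean_space \<Rightarrow> real"
  shows "continuous_on UNIV f \<Longrightarrow> f \<in> borel_measurable lebesgue"
  by (simp add: borel_measurable_continuous_onI measurable_completion)

lemma integrable_indicator_continuous:
  fixes f :: "'a::euclidean_space \<Rightarrow> real"
  assumes "continuous_on UNIV f" "compact S"
  shows "integrable lebesgue (\<lambda>x. indicator S x * f x)"
proof -
  have "integrable lborel (\<lambda>x. indicator S x * f x)"
    using borel_integrable_compact[OF assms(2) continuous_on_subset[OF assms(1)]] by simp
  moreover have "f \<in> borel_measurable borel"
    using assms(1) by (rule borel_measurable_continuous_onI)
  ultimately show ?thesis
    using assms by (subst integrable_completion) (auto intro!: borel_measurable_times)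
qed

lemma integrable_continuous_compact_support:
  fixes f :: "'a::euclidean_space \<Rightarrow> real"
  assumes "continuous_on UNIV f" "compact S" "\<And>x. x \<notin> S \<Longrightarrow> f x = 0"
  shows "integrable lebesgue f"
proof -
  have "(\<lambda>x. indicator S x * f x) = f"
    using assms(3) by (intro ext) (auto simp: indicator_def)
  then show ?thesis using integrable_indicator_continuous[OF assms(1,2)] by simp
qed

lemma continuous_on_bump: "continuous_on A (bump n z r)"
  using Ck_fun_bump[of 0 n z r] continuous_on_subset by fastforce

lemma continuous_on_laplacian_bump: "continuous_on A (laplacian (bump 0 z r))"
  unfolding laplacian_bump[abs_def]
  by (cases "r = 0") (auto intro!: continuous_intros continuous_on_bump)

lemma laplacian_bump_eq_0:
  "0 < r \<Longrightarrow> x \<notin> ball z r \<Longrightarrow> laplacian (bump 0 z r) x = 0"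
  by (simp add: laplacian_bump bump_eq_0)

lemma integrable_mult_bump:
  assumes "continuous_on UNIV g" "0 < r"
  shows "integrable lebesgue (\<lambda>x. g x * bump n z r x)"
  by (rule integrable_continuous_compact_support[where S="cball z r"])
    (use assms bump_eq_0 in \<open>auto intro!: continuous_intros continuous_on_bump\<close>)

text \<open>The bump is an admissible test function. All integrands are continuous with compact
  support, which justifies splitting the integral and moving the Laplacian to one side.\<close>

lemma eigenpair_bump:
  assumes "eigenpair V u E" "continuous_on UNIV V" "0 < r"
  shows "(\<integral>x. u x * laplacian (bump 0 z r) x \<partial>lebesgue) =
         (\<integral>x. ((V x - E) * u x) * bump 0 z r x \<partial>lebesgue)"
proof -
  let ?b = "bump 0 z r"
  have u: "continuous_on UNIV u" using assms(1) by (simp add: eigenpair_def)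
  have I1: "integrable lebesgue (\<lambda>x. u x * laplacian ?b x)"
    by (rule integrable_continuous_compact_support[where S="cball z r"])
      (use u assms(3) laplacian_bump_eq_0 in \<open>auto intro!: continuous_intros continuous_on_laplacian_bump\<close>)
  have I2: "integrable lebesgue (\<lambda>x. (V x * u x) * ?b x)" "integrable lebesgue (\<lambda>x. (E * u x) * ?b x)"
    using assms u by (auto intro!: integrable_mult_bump continuous_intros)
  have "(\<integral>x. u x * (- laplacian ?b x + V x * ?b x) \<partial>lebesgue) = (\<integral>x. (E * u x) * ?b x \<partial>lebesgue)"
    using assms test_function_bump[OF assms(3)] by (simp add: eigenpair_def schroedinger_graph_def)
  moreover have "(\<lambda>x. u x * (- laplacian ?b x + V x * ?b x)) = (\<lambda>x. (V x * u x) * ?b x - u x * laplacian ?b x)"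
    by (auto simp: algebra_simps)
  moreover have "(\<lambda>x. ((V x - E) * u x) * ?b x) = (\<lambda>x. (V x * u x) * ?b x - (E * u x) * ?b x)"
    by (auto simp: algebra_simps)
  ultimately show ?thesis
    using I1 I2 by simp
qed

lemma eigenpair_uminus: "eigenpair V u E \<Longrightarrow> eigenpair V (\<lambda>x. - u x) E"
  unfolding eigenpair_def schroedinger_graph_def square_integrable_def
  by (auto intro!: continuous_intros simp del: neg_equal_iff_equal)

text \<open>Testing with the bump gives integral 0 for \<open>u\<close> times
  \<open>(E - V) * b + laplacian b\<close>, where \<open>b\<close> is the bump. By
  \<open>laplacian_bump_ge\<close> and the gap between \<open>V\<close> and \<open>E\<close> this
  integrand is positive on the disc, a set of positive measure, and it vanishes outside.\<close>

lemma eigenpair_pos_ball_False: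
  assumes "eigenpair V u E" "continuous_on UNIV V" "0 < r"
    and "\<And>x. x \<in> ball z r \<Longrightarrow> 0 < u x"
    and "\<And>x. x \<in> ball z r \<Longrightarrow> V x + 324 / r\<^sup>2 < E"
  shows False
proof -
  let ?b = "bump 0 z r"
  define f where "f x = ((E - V x) * u x) * ?b x + u x * laplacian ?b x" for x
  have u: "continuous_on UNIV u" using assms(1) by (simp add: eigenpair_def)
  have I1: "integrable lebesgue (\<lambda>x. u x * laplacian ?b x)"
    by (rule integrable_continuous_compact_support[where S="cball z r"])
      (use u assms(3) laplacian_bump_eq_0 in \<open>auto intro!: continuous_intros continuous_on_laplacian_bump\<close>)
  have I2: "integrable lebesgue (\<lambda>x. ((V x - E) * u x) * ?b x)"
    using assms u by (auto intro!: integrable_mult_bump continuous_intros)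
  have f_eq: "f = (\<lambda>x. u x * laplacian ?b x - ((V x - E) * u x) * ?b x)"
    by (auto simp: f_def algebra_simps)
  have "integral\<^sup>L lebesgue f = 0"
    unfolding f_eq using eigenpair_bump[OF assms(1-3)] I1 I2 by simp
  moreover have int: "integrable lebesgue f"
    unfolding f_eq using I1 I2 by simp
  moreover have pos: "0 < f x" if x: "x \<in> ball z r" for x
  proof -
    have "- laplacian ?b x \<le> 324 / r\<^sup>2 * ?b x" using laplacian_bump_ge[OF assms(3)] .
    also have "\<dots> < (E - V x) * ?b x"
      using assms(5)[OF x] bump_pos[OF x] by (intro mult_strict_right_mono) auto
    finally have "0 < u x * ((E - V x) * ?b x + laplacian ?b x)"
      using assms(4)[OF x] by simp
    then show ?thesis by (simp add: f_def algebra_simps)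
  qed
  moreover have f0: "f x = 0" if "x \<notin> ball z r" for x
    using that assms(3) by (simp add: f_def laplacian_bump_eq_0 bump_eq_0)
  ultimately have "AE x in lebesgue. f x = 0"
    using integral_nonneg_eq_0_iff_AE[OF int] by (metis (mono_tags, lifting) always_eventually less_eq_real_def)
  then have "AE x in lebesgue. x \<notin> ball z r"
    by (rule eventually_mono) (use pos in fastforce)
  then have "ball z r \<in> null_sets lebesgue"
    by (subst AE_iff_null_sets) auto
  then have "emeasure lebesgue (ball z r) = 0" by auto
  then show False
    using assms(3) by (simp add: emeasure_ball unit_ball_vol_2)
qed

lemma DERIV_along_axis:
  assumes "f differentiable at (x + t *\<^sub>R axis i 1)"
  shows "((\<lambda>t. f (x + t *\<^sub>R axis i 1)) has_real_derivative partial_deriv i f (x + t *\<^sub>R axis i 1)) (at t)"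
proof -
  have D: "(f has_derivative frechet_derivative f (at (x + t *\<^sub>R axis i 1))) (at (x + t *\<^sub>R axis i 1))"
    using assms frechet_derivative_works by blast
  have "((\<lambda>t. x + t *\<^sub>R axis i 1) has_derivative (\<lambda>h. h *\<^sub>R axis i 1)) (at t)"
    by (auto intro!: derivative_eq_intros)
  from has_derivative_compose[OF this D]
  show ?thesis
    unfolding has_field_derivative_def partial_deriv_def
    by (rule has_derivative_eq_rhs)
      (use linear_frechet_derivative[OF assms] in \<open>auto simp: linear_cmul\<close>)
qed

text \<open>This is Taylor's formula of order two with Lagrange remainder, applied to the symmetric
  difference as a function of the step length.\<close>

lemma second_difference_mean_value:
  assumes "Ck_fun 2 \<phi>" "0 < h"
  obtains \<xi> where "0 < \<xi>" "\<xi> < h"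
    "\<phi> (x + h *\<^sub>R axis i 1) + \<phi> (x - h *\<^sub>R axis i 1) - 2 * \<phi> x =
     h\<^sup>2 / 2 * (partial_deriv i (partial_deriv i \<phi>) (x + \<xi> *\<^sub>R axis i 1)
             + partial_deriv i (partial_deriv i \<phi>) (x - \<xi> *\<^sub>R axis i 1))"
proof -
  let ?e = "axis i 1 :: real^2"
  define p where "p = partial_deriv i \<phi>"
  define q where "q = partial_deriv i p"
  have d: "\<phi> differentiable at x" "p differentiable at x" for x
    using assms(1) by (auto simp: p_def numeral_2_eq_2)
  have D: "((\<lambda>t. \<phi> (x + t *\<^sub>R ?e)) has_real_derivative p (x + t *\<^sub>R ?e)) (at t)"
     "((\<lambda>t. p (x + t *\<^sub>R ?e)) has_real_derivative q (x + t *\<^sub>R ?e)) (at t)" for t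
    unfolding p_def q_def by (intro DERIV_along_axis d d[unfolded p_def])+
  have M: "((\<lambda>t. \<phi> (x - t *\<^sub>R ?e)) has_real_derivative - p (x - t *\<^sub>R ?e)) (at t)"
     "((\<lambda>t. p (x - t *\<^sub>R ?e)) has_real_derivative - q (x - t *\<^sub>R ?e)) (at t)" for t
  proof -
    have "(uminus has_real_derivative -1) (at t)"
      by (auto intro!: derivative_eq_intros)
    from DERIV_chain2[where f="\<lambda>t. \<phi> (x + t *\<^sub>R ?e)", OF D(1) this]
      DERIV_chain2[where f="\<lambda>t. p (x + t *\<^sub>R ?e)", OF D(2) this]
    show "((\<lambda>t. \<phi> (x - t *\<^sub>R ?e)) has_real_derivative - p (x - t *\<^sub>R ?e)) (at t)"
     "((\<lambda>t. p (x - t *\<^sub>R ?e)) has_real_derivative - q (x - t *\<^sub>R ?e)) (at t)"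
      by simp_all
  qed
  \<comment> \<open>The symmetric difference and its first two derivatives. Those of index 0 and 1
    vanish at \<open>t = 0\<close>, so only the remainder term survives in the Maclaurin
    expansion.\<close>
  define diff where "diff m t =
    (if m = (0::nat) then \<phi> (x + t *\<^sub>R ?e) + \<phi> (x - t *\<^sub>R ?e) - 2 * \<phi> x
     else if m = 1 then p (x + t *\<^sub>R ?e) - p (x - t *\<^sub>R ?e)
     else q (x + t *\<^sub>R ?e) + q (x - t *\<^sub>R ?e))" for m t
  have "DERIV (diff m) t :> diff (Suc m) t" if m: "m < 2" for m t
  proof -
    consider "m = 0" | "m = 1" using m by linarith
    then show ?thesis
    proof cases
      case 1
      have "((\<lambda>t. \<phi> (x + t *\<^sub>R ?e) + \<phi> (x - t *\<^sub>R ?e) - 2 * \<phi> x) has_real_derivative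
         p (x + t *\<^sub>R ?e) + - p (x - t *\<^sub>R ?e) - 0) (at t)"
        by (intro DERIV_diff DERIV_add D M DERIV_const)
      then show ?thesis using 1 by (simp add: diff_def[abs_def])
    next
      case 2
      have "((\<lambda>t. p (x + t *\<^sub>R ?e) - p (x - t *\<^sub>R ?e)) has_real_derivative
         q (x + t *\<^sub>R ?e) - - q (x - t *\<^sub>R ?e)) (at t)"
        by (intro DERIV_diff DERIV_add D M DERIV_const)
      then show ?thesis using 2 by (simp add: diff_def[abs_def])
    qed
  qed
  then obtain \<xi> where "0 < \<xi>" "\<xi> < h"
    "diff 0 h = (\<Sum>m<2. diff m 0 / fact m * h ^ m) + diff 2 \<xi> / fact 2 * h ^ 2"
    using Maclaurin[OF assms(2), of 2 diff "diff 0"] by auto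
  then show thesis
    by (intro that[of \<xi>]) (simp_all add: diff_def numeral_2_eq_2 p_def q_def)
qed

subsection \<open>Mollification\<close>

text \<open>By the mean value form, the difference quotient averages the second derivative at two
  points within \<open>h n\<close> of \<open>x\<close>. It therefore converges pointwise and is
  bounded on a fixed disc, so dominated convergence applies.\<close>

lemma tendsto_integral_second_difference:
  assumes "Ck_fun 2 \<phi>" "continuous_on UNIV u"
    and supp: "\<And>x. x \<notin> cball z R \<Longrightarrow> \<phi> x = 0"
    and h: "\<And>n. 0 < h n" "\<And>n. h n \<le> 1" "h \<longlonglongrightarrow> 0"
  shows "(\<lambda>n. (\<integral>x. u x * (\<phi> (x + h n *\<^sub>R axis i 1) + \<phi> (x - h n *\<^sub>R axis i 1) - 2 * \<phi> x) \<partial>lebesgue) / (h n)\<^sup>2)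
     \<longlonglongrightarrow> (\<integral>x. u x * partial_deriv i (partial_deriv i \<phi>) x \<partial>lebesgue)"
proof -
  let ?e = "axis i 1 :: real^2"
  define q where "q = partial_deriv i (partial_deriv i \<phi>)"
  have q: "continuous_on UNIV q" and \<phi>: "continuous_on UNIV \<phi>"
    using assms(1) Ck_fun_Suc_imp[of 0 \<phi>] Ck_fun_Suc_imp[of 1 \<phi>] by (auto simp: q_def numeral_2_eq_2)
  define d where "d n x = \<phi> (x + h n *\<^sub>R ?e) + \<phi> (x - h n *\<^sub>R ?e) - 2 * \<phi> x" for n x
  have "\<exists>\<xi>. 0 < \<xi> \<and> \<xi> < h n \<and> d n x = (h n)\<^sup>2 / 2 * (q (x + \<xi> *\<^sub>R ?e) + q (x - \<xi> *\<^sub>R ?e))" for n x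
    unfolding d_def q_def using second_difference_mean_value[OF assms(1) h(1)] by metis
  then obtain \<xi> where \<xi>: "\<And>n x. 0 < \<xi> n x" "\<And>n x. \<xi> n x < h n"
    "\<And>n x. d n x = (h n)\<^sup>2 / 2 * (q (x + \<xi> n x *\<^sub>R ?e) + q (x - \<xi> n x *\<^sub>R ?e))"
    by metis
  have dq: "d n x / (h n)\<^sup>2 = (q (x + \<xi> n x *\<^sub>R ?e) + q (x - \<xi> n x *\<^sub>R ?e)) / 2" for n x
    using h(1)[of n] unfolding \<xi>(3) by simp
  \<comment> \<open>Quotients vanish outside radius \<open>R + 1\<close>, since steps are at most 1;
    the intermediate points shift by at most 1 more, which gives \<open>R + 2\<close>.\<close>
  have "compact (q ` cball z (R + 2))"
    by (intro compact_continuous_image continuous_on_subset[OF q]) auto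
  then obtain B where B: "\<And>x. x \<in> cball z (R + 2) \<Longrightarrow> \<bar>q x\<bar> \<le> B"
    using compact_imp_bounded bounded_real by (metis imageI)
  have near: "x + t *\<^sub>R ?e \<in> cball z (S + 1)" if "x \<in> cball z S" "\<bar>t\<bar> \<le> 1" for x t S
    using that norm_triangle_ineq4[of "z - x" "t *\<^sub>R ?e"] by (simp add: dist_norm diff_diff_eq)
  have d0: "d n x = 0" if "x \<notin> cball z (R + 1)" for n x
  proof -
    have "x \<notin> cball z R" using that by auto
    moreover have "x + h n *\<^sub>R ?e \<notin> cball z R"
      using near[of "x + h n *\<^sub>R ?e" R "- h n"] that h(1,2)[of n] by auto
    moreover have "x - h n *\<^sub>R ?e \<notin> cball z R"
      using near[of "x - h n *\<^sub>R ?e" R "h n"] that h(1,2)[of n] by auto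
    ultimately show ?thesis by (simp add: d_def supp)
  qed
  have "(\<lambda>n. \<integral>x. u x * (d n x / (h n)\<^sup>2) \<partial>lebesgue) \<longlonglongrightarrow> (\<integral>x. u x * q x \<partial>lebesgue)"
  proof (rule integral_dominated_convergence[where w="\<lambda>x. indicator (cball z (R + 1)) x * (\<bar>u x\<bar> * B)"])
    show "(\<lambda>x. u x * q x) \<in> borel_measurable lebesgue"
      by (intro borel_measurable_lebesgue_continuous continuous_intros assms(2) q)
    have "continuous_on UNIV (d n)" for n
      unfolding d_def[abs_def]
      by (intro continuous_intros continuous_on_compose2[OF \<phi>]) auto
    then show "(\<lambda>x. u x * (d n x / (h n)\<^sup>2)) \<in> borel_measurable lebesgue" for n
      using h(1)[of n] by (intro borel_measurable_lebesgue_continuous continuous_intros assms(2)) auto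
    show "integrable lebesgue (\<lambda>x. indicator (cball z (R + 1)) x * (\<bar>u x\<bar> * B))"
      by (intro integrable_indicator_continuous continuous_intros assms(2)) auto
    show "AE x in lebesgue. (\<lambda>n. u x * (d n x / (h n)\<^sup>2)) \<longlonglongrightarrow> u x * q x"
    proof (intro always_eventually allI tendsto_mult tendsto_const)
      fix x
      have \<xi>0: "(\<lambda>n. \<xi> n x) \<longlonglongrightarrow> 0"
        by (rule tendsto_sandwich[OF _ _ tendsto_const h(3)])
          (use \<xi>(1,2) in \<open>auto intro!: always_eventually less_imp_le\<close>)
      have qt: "(\<lambda>n. q (g n)) \<longlonglongrightarrow> q x" if "g \<longlonglongrightarrow> x" for g
        using continuous_on_tendsto_compose[OF q that] by simp
      have "(\<lambda>n. (q (x + \<xi> n x *\<^sub>R ?e) + q (x - \<xi> n x *\<^sub>R ?e)) / 2) \<longlonglongrightarrow> (q x + q x) / 2"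
        by (intro tendsto_intros qt) (use \<xi>0 in \<open>auto intro!: tendsto_eq_intros\<close>)
      then show "(\<lambda>n. d n x / (h n)\<^sup>2) \<longlonglongrightarrow> q x" by (simp add: dq)
    qed
    show "AE x in lebesgue. norm (u x * (d n x / (h n)\<^sup>2)) \<le> indicator (cball z (R + 1)) x * (\<bar>u x\<bar> * B)" for n
    proof (intro always_eventually allI)
      fix x
      show "norm (u x * (d n x / (h n)\<^sup>2)) \<le> indicator (cball z (R + 1)) x * (\<bar>u x\<bar> * B)"
      proof (cases "x \<in> cball z (R + 1)")
        case True
        have "x + \<xi> n x *\<^sub>R ?e \<in> cball z (R + 2)"
          using near[OF True, of "\<xi> n x"] \<xi>(1,2)[of n x] h(2)[of n] by (simp add: add.assoc)
        moreover have "x - \<xi> n x *\<^sub>R ?e \<in> cball z (R + 2)"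
          using near[OF True, of "- \<xi> n x"] \<xi>(1,2)[of n x] h(2)[of n] by (simp add: add.assoc)
        ultimately have "\<bar>q (x + \<xi> n x *\<^sub>R ?e)\<bar> \<le> B" "\<bar>q (x - \<xi> n x *\<^sub>R ?e)\<bar> \<le> B"
          using B by blast+
        then have dB: "\<bar>d n x / (h n)\<^sup>2\<bar> \<le> B"
          unfolding dq by (simp add: abs_le_iff)
        show ?thesis
          using True mult_left_mono[OF dB, of "\<bar>u x\<bar>"] by (simp add: abs_mult)
      qed (simp add: d0)
    qed
  qed
  then show ?thesis by (simp add: d_def q_def)
qed

lemma integral_bump_translate: "(\<integral>x. bump n z r x \<partial>lebesgue) = (\<integral>x. bump n 0 r x \<partial>lebesgue)"
proof -
  have m: "bump n z r \<in> borel_measurable borel" for z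
    by (rule borel_measurable_continuous_onI[OF continuous_on_bump])
  have "(\<integral>x. bump n z r x \<partial>lborel) = (\<integral>x. bump n z r x \<partial>distr lborel borel ((+) z))"
    by (simp add: lborel_distr_plus)
  also have "\<dots> = (\<integral>x. bump n z r (z + x) \<partial>lborel)"
    by (rule integral_distr) (use m in auto)
  also have "\<dots> = (\<integral>x. bump n 0 r x \<partial>lborel)" by (simp add: bump_def)
  finally show ?thesis using m by (simp add: integral_completion)
qed

lemma integral_bump_pos:
  assumes "0 < r"
  shows "0 < (\<integral>x. bump n z r x \<partial>lebesgue)"
proof -
  have int: "integrable lebesgue (bump n z r)"
    using integrable_mult_bump[of "\<lambda>x. 1" r n z] assms by simp
  have "(\<integral>x. bump n z r x \<partial>lebesgue) \<noteq> 0"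
  proof
    assume "(\<integral>x. bump n z r x \<partial>lebesgue) = 0"
    then have "AE x in lebesgue. bump n z r x = 0"
      using integral_nonneg_eq_0_iff_AE[OF int] bump_nonneg by auto
    then have "AE x in lebesgue. x \<notin> ball z r"
      by (rule eventually_mono) (metis bump_pos less_irrefl)
    then have "ball z r \<in> null_sets lebesgue"
      by (subst AE_iff_null_sets) auto
    then have "emeasure lebesgue (ball z r) = 0" by auto
    then show False using assms by (simp add: emeasure_ball unit_ball_vol_2)
  qed
  moreover have "0 \<le> (\<integral>x. bump n z r x \<partial>lebesgue)"
    by (rule Bochner_Integration.integral_nonneg) (simp add: bump_nonneg)
  ultimately show ?thesis by simp
qed

text \<open>Convolution with the normalised bump. The normalising integral is taken at the origin,
  as it does not depend on the centre.\<close>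

definition mollify :: "real \<Rightarrow> (real^2 \<Rightarrow> real) \<Rightarrow> real^2 \<Rightarrow> real" where
  "mollify r g z = (\<integral>x. g x * bump 0 z r x \<partial>lebesgue) / (\<integral>x. bump 0 0 r x \<partial>lebesgue)"

text \<open>The mollified value is a weighted mean of \<open>g\<close> over a disc of radius
  \<open>r\<close>, so its error is at most the oscillation of \<open>g\<close> there. Uniform
  continuity on a unit enlargement of a disc containing \<open>K\<close> makes this small for all
  centres at once.\<close>

lemma mollify_close:
  assumes g: "continuous_on UNIV g" and "compact K" "0 < \<theta>"
  obtains \<epsilon> where "0 < \<epsilon>" "\<And>r z. 0 < r \<Longrightarrow> r \<le> \<epsilon> \<Longrightarrow> z \<in> K \<Longrightarrow> \<bar>mollify r g z - g z\<bar> \<le> \<theta>"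
proof -
  obtain R where R: "K \<subseteq> cball 0 R"
    using bounded_subset_ballD[OF compact_imp_bounded[OF assms(2)]] ball_subset_cball by (metis subset_trans)
  have "uniformly_continuous_on (cball 0 (R + 1)) g"
    by (intro compact_uniformly_continuous continuous_on_subset[OF g]) auto
  then obtain e where e: "0 < e" "\<And>x x'. x \<in> cball 0 (R + 1) \<Longrightarrow> x' \<in> cball 0 (R + 1) \<Longrightarrow> dist x' x < e \<Longrightarrow> dist (g x') (g x) < \<theta>"
    using assms(3) unfolding uniformly_continuous_on_def by metis
  show thesis
  proof (rule that[of "min e 1"])
    fix r z assume r: "0 < r" "r \<le> min e 1" and z: "z \<in> K"
    let ?J = "\<integral>x. bump 0 z r x \<partial>lebesgue"
    have J: "0 < ?J" using integral_bump_pos[OF r(1)] .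
    have I: "integrable lebesgue (\<lambda>x. g x * bump 0 z r x)" "integrable lebesgue (\<lambda>x. g z * bump 0 z r x)"
      "integrable lebesgue (\<lambda>x. \<theta> * bump 0 z r x)"
      by (intro integrable_mult_bump g r(1) continuous_on_const)+
    have zR: "z \<in> cball 0 (R + 1)" using z R by auto
    have "\<bar>(\<integral>x. g x * bump 0 z r x \<partial>lebesgue) - g z * ?J\<bar>
        = \<bar>\<integral>x. g x * bump 0 z r x - g z * bump 0 z r x \<partial>lebesgue\<bar>"
      using I by simp
    also have "\<dots> \<le> (\<integral>x. \<bar>g x * bump 0 z r x - g z * bump 0 z r x\<bar> \<partial>lebesgue)"
      by (rule integral_abs_bound)
    also have "\<dots> \<le> (\<integral>x. \<theta> * bump 0 z r x \<partial>lebesgue)"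
    proof (rule integral_mono)
      fix x
      show "\<bar>g x * bump 0 z r x - g z * bump 0 z r x\<bar> \<le> \<theta> * bump 0 z r x"
      proof (cases "x \<in> ball z r")
        case True
        then have "x \<in> cball 0 (R + 1)"
          using z R r dist_triangle[of 0 x z] by (auto simp: subset_iff)
        then have "dist (g x) (g z) < \<theta>"
          using True r zR by (intro e) (auto simp: dist_commute)
        then have "\<bar>g x - g z\<bar> * bump 0 z r x \<le> \<theta> * bump 0 z r x"
          by (intro mult_right_mono bump_nonneg) (simp add: dist_real_def)
        then show ?thesis
          by (simp add: left_diff_distrib[symmetric] abs_mult bump_nonneg)
      qed (simp add: bump_eq_0 r)
    qed (use I in auto)
    also have "\<dots> = \<theta> * ?J" by simp
    finally have "\<bar>(\<integral>x. g x * bump 0 z r x \<partial>lebesgue) - g z * ?J\<bar> / ?J \<le> \<theta>"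
      using J by (simp add: divide_simps)
    moreover have "mollify r g z - g z = ((\<integral>x. g x * bump 0 z r x \<partial>lebesgue) - g z * ?J) / ?J"
      using J by (simp add: mollify_def integral_bump_translate[of 0 z, symmetric] diff_divide_distrib)
    ultimately show "\<bar>mollify r g z - g z\<bar> \<le> \<theta>"
      using J by (simp add: abs_divide)
  qed (use e in auto)
qed

lemma bump_0_le_1: "bump 0 z r x \<le> 1"
  by (simp add: bump_def flat_def)

text \<open>Along a convergent sequence of centres the supports stay in one fixed disc, and bumps of
  index 0 are at most 1. Dominated convergence then applies.\<close>

lemma continuous_on_mollify:
  assumes g: "continuous_on UNIV g" and r: "0 < r"
  shows "continuous_on A (mollify r g)"
proof -
  have "continuous_on A (\<lambda>z. \<integral>x. g x * bump 0 z r x \<partial>lebesgue)"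
  proof (rule continuous_on_sequentiallyI)
    fix zs :: "nat \<Rightarrow> real^2" and z assume zs: "zs \<longlonglongrightarrow> z"
    have "bounded (insert z (range zs))"
      using convergent_imp_bounded[OF zs] by simp
    then obtain R where R: "insert z (range zs) \<subseteq> cball 0 R"
      using bounded_subset_ballD ball_subset_cball by (metis subset_trans)
    show "(\<lambda>n. \<integral>x. g x * bump 0 (zs n) r x \<partial>lebesgue) \<longlonglongrightarrow> (\<integral>x. g x * bump 0 z r x \<partial>lebesgue)"
    proof (rule integral_dominated_convergence[where w="\<lambda>x. indicator (cball 0 (R + r)) x * \<bar>g x\<bar>"])
      show "(\<lambda>x. g x * bump 0 z r x) \<in> borel_measurable lebesgue" for z
        by (intro borel_measurable_lebesgue_continuous continuous_intros g continuous_on_bump)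
      then show "(\<lambda>x. g x * bump 0 (zs n) r x) \<in> borel_measurable lebesgue" for n .
      show "integrable lebesgue (\<lambda>x. indicator (cball 0 (R + r)) x * \<bar>g x\<bar>)"
        by (intro integrable_indicator_continuous continuous_intros g) auto
      show "AE x in lebesgue. (\<lambda>n. g x * bump 0 (zs n) r x) \<longlonglongrightarrow> g x * bump 0 z r x"
      proof (intro always_eventually allI tendsto_mult tendsto_const)
        fix x
        have "isCont (flat 0) t" for t using flat_has_derivative DERIV_isCont by blast
        then show "(\<lambda>n. bump 0 (zs n) r x) \<longlonglongrightarrow> bump 0 z r x"
          unfolding bump_def by (intro isCont_tendsto_compose[of _ "flat 0"] tendsto_intros zs) (use r in auto)
      qed
      show "AE x in lebesgue. norm (g x * bump 0 (zs n) r x) \<le> indicator (cball 0 (R + r)) x * \<bar>g x\<bar>" for n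
      proof (intro always_eventually allI)
        fix x
        show "norm (g x * bump 0 (zs n) r x) \<le> indicator (cball 0 (R + r)) x * \<bar>g x\<bar>"
        proof (cases "x \<in> ball (zs n) r")
          case True
          have "zs n \<in> cball 0 R" using R by blast
          with True have "x \<in> cball 0 (R + r)"
            using dist_triangle[of 0 x "zs n"] by auto
          then show ?thesis
            using bump_0_le_1[of "zs n" r x] bump_nonneg[of 0 "zs n" r x]
            by (simp add: abs_mult mult_left_le)
        qed (simp add: bump_eq_0 r)
      qed
    qed
  qed
  then show ?thesis
    unfolding mollify_def[abs_def]
    using integral_bump_pos[OF r, of 0 0] by (intro continuous_intros) auto
qed

subsection \<open>Zeros of eigenfunctions on small discs and circles\<close>

lemma partial_deriv_eq_0_open:
  assumes "open S" "\<And>x. x \<in> S \<Longrightarrow> f x = 0" "x \<in> S"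
  shows "partial_deriv i f x = 0"
proof -
  have "(f has_derivative (\<lambda>h. 0)) (at x)"
    by (rule has_derivative_transform_within_open[OF has_derivative_const[of 0] assms(1,3)])
      (simp add: assms(2))
  then show ?thesis by (simp add: partial_deriv_eq)
qed

text \<open>Moving the centre by \<open>h\<close> is the same as moving the argument of the bump by
  \<open>- h\<close>. Differences of the mollified function thus become integrals of
  \<open>u\<close> against differences of a single test function.\<close>

lemma mollify_second_difference:
  assumes "continuous_on UNIV u" "0 < r"
  shows "mollify r u (z + h) + mollify r u (z - h) - 2 * mollify r u z =
    (\<integral>x. u x * (bump 0 z r (x + h) + bump 0 z r (x - h) - 2 * bump 0 z r x) \<partial>lebesgue)
      / (\<integral>x. bump 0 0 r x \<partial>lebesgue)"
proof -
  have "bump 0 z r (x + h) = bump 0 (z - h) r x" "bump 0 z r (x - h) = bump 0 (z + h) r x" for x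
    by (simp_all add: bump_def algebra_simps)
  moreover have "integrable lebesgue (\<lambda>x. u x * bump 0 z r x)" for z
    by (intro integrable_mult_bump assms)
  moreover have "(\<lambda>x. u x * (bump 0 (z - h) r x + bump 0 (z + h) r x - 2 * bump 0 z r x))
    = (\<lambda>x. u x * bump 0 (z - h) r x + u x * bump 0 (z + h) r x - 2 * (u x * bump 0 z r x))"
    by (auto simp: algebra_simps)
  ultimately have "(\<integral>x. u x * (bump 0 z r (x + h) + bump 0 z r (x - h) - 2 * bump 0 z r x) \<partial>lebesgue)
    = (\<integral>x. u x * bump 0 (z + h) r x \<partial>lebesgue) + (\<integral>x. u x * bump 0 (z - h) r x \<partial>lebesgue)
      - 2 * (\<integral>x. u x * bump 0 z r x \<partial>lebesgue)"
    by simp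
  then show ?thesis by (simp add: mollify_def add_divide_distrib diff_divide_distrib)
qed

text \<open>
  Since \<open>E s\<^sup>2 \<le> 1\<close>, the function \<open>\<psi> = 3 - E |x - y|\<^sup>2\<close> satisfies \<open>2 \<le> \<psi> \<le> 3\<close> on the disc and
  \<open>- \<Delta> \<psi> = 4 E > (E - V) \<psi>\<close>. At an interior minimum of \<open>(u - \<tau>) / \<psi>\<close> with negative value
  this contradicts the equation; mollification replaces the regularity theory of \<open>u\<close>.
\<close>

lemma eigenpair_pos_sphere_imp_pos_centre:
  assumes eig: "eigenpair V u E" "continuous_on UNIV V"
    and s: "0 < s" "0 < E" "E * s\<^sup>2 \<le> 1"
    and V: "\<And>x. x \<in> cball y s \<Longrightarrow> 0 \<le> V x \<and> V x \<le> E"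
    and pos: "\<And>x. x \<in> sphere y s \<Longrightarrow> 0 < u x"
  shows "0 < u y"
proof (rule ccontr)
  assume "\<not> 0 < u y"
  then have uy: "u y \<le> 0" by simp
  have u: "continuous_on UNIV u" using eig(1) by (simp add: eigenpair_def)
  \<comment> \<open>The factor 2 leaves a gap between the boundary values and \<open>\<tau>\<close>
    that survives the mollification error \<open>\<tau> / 4\<close>.\<close>
  obtain \<tau> where \<tau>: "0 < \<tau>" "\<And>x. x \<in> sphere y s \<Longrightarrow> 2 * \<tau> \<le> u x"
  proof -
    obtain p where "p \<in> sphere y s" "\<And>x. x \<in> sphere y s \<Longrightarrow> u p \<le> u x"
      using continuous_attains_inf[of "sphere y s" u] s(1) continuous_on_subset[OF u] by auto
    then show thesis using pos[of p] by (intro that[of "u p / 2"]) auto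
  qed
  define \<psi> where "\<psi> x = 3 - E * ((x - y) \<bullet> (x - y))" for x :: "real^2"
  have \<psi>: "2 \<le> \<psi> x" "\<psi> x \<le> 3" if "x \<in> cball y s" for x
  proof -
    have "(x - y) \<bullet> (x - y) \<le> s\<^sup>2"
      using that s(1) unfolding power2_norm_eq_inner[symmetric]
      by (intro power_mono) (auto simp: dist_norm norm_minus_commute)
    then have "E * ((x - y) \<bullet> (x - y)) \<le> E * s\<^sup>2" using s(2) by (intro mult_left_mono) auto
    then show "2 \<le> \<psi> x" using s(3) by (simp add: \<psi>_def)
    show "\<psi> x \<le> 3" using s(2) by (simp add: \<psi>_def)
  qed
  have \<psi>_cont: "continuous_on A \<psi>" for A
    unfolding \<psi>_def[abs_def] by (intro continuous_intros)
  have "continuous_on (cball y s) (\<lambda>x. (u x - \<tau>) / \<psi> x)"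
    using \<psi>(1) by (intro continuous_intros continuous_on_subset[OF u] \<psi>_cont) fastforce+
  then obtain x0 where x0: "x0 \<in> cball y s"
    "\<And>x. x \<in> cball y s \<Longrightarrow> (u x0 - \<tau>) / \<psi> x0 \<le> (u x - \<tau>) / \<psi> x"
    using continuous_attains_inf[of "cball y s" "\<lambda>x. (u x - \<tau>) / \<psi> x"] s(1) by auto
  \<comment> \<open>The graph of \<open>\<tau> + m * \<psi>\<close> touches that of \<open>u\<close>
    from below at \<open>x0\<close>; the value at the centre \<open>y\<close> forces
    \<open>m\<close> to be negative.\<close>
  define m where "m = (u x0 - \<tau>) / \<psi> x0"
  have "m \<le> (u y - \<tau>) / \<psi> y" unfolding m_def using s(1) by (intro x0) auto
  also have "\<dots> < 0" using uy \<tau>(1) by (simp add: \<psi>_def)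
  finally have m: "m < 0" .
  have ux0: "u x0 = \<tau> + m * \<psi> x0"
    using \<psi>(1)[OF x0(1)] by (simp add: m_def)
  have low: "\<tau> + m * \<psi> x \<le> u x" if "x \<in> cball y s" for x
    using x0(2)[OF that] \<psi>(1)[OF that] by (simp add: m_def[symmetric] pos_le_divide_eq)
  define v where "v x = (V x - E) * u x" for x
  have v: "continuous_on UNIV v"
    unfolding v_def[abs_def] by (intro continuous_intros eig u)
  obtain \<epsilon>1 where \<epsilon>1: "0 < \<epsilon>1"
    "\<And>r z. 0 < r \<Longrightarrow> r \<le> \<epsilon>1 \<Longrightarrow> z \<in> cball y s \<Longrightarrow> \<bar>mollify r u z - u z\<bar> \<le> \<tau> / 4"
    using mollify_close[OF u, of "cball y s" "\<tau> / 4"] \<tau>(1) by auto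
  have "0 < - (E * m / 2)" using m s(2) by (simp add: mult_pos_neg)
  from mollify_close[OF v compact_cball this]
  obtain \<epsilon>2 where \<epsilon>2: "0 < \<epsilon>2"
    "\<And>r z. 0 < r \<Longrightarrow> r \<le> \<epsilon>2 \<Longrightarrow> z \<in> cball y s \<Longrightarrow> \<bar>mollify r v z - v z\<bar> \<le> - (E * m / 2)"
    by metis
  define r where "r = min \<epsilon>1 \<epsilon>2"
  have r: "0 < r" "r \<le> \<epsilon>1" "r \<le> \<epsilon>2" using \<epsilon>1(1) \<epsilon>2(1) by (auto simp: r_def)
  define W where "W x = mollify r u x - m * \<psi> x" for x
  have "continuous_on (cball y s) W"
    unfolding W_def[abs_def] by (intro continuous_intros continuous_on_mollify u r \<psi>_cont)
  then obtain z where z: "z \<in> cball y s" "\<And>x. x \<in> cball y s \<Longrightarrow> W z \<le> W x"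
    using continuous_attains_inf[of "cball y s" W] s(1) by auto
  \<comment> \<open>On the circle \<open>W\<close> is at least \<open>7 * \<tau> / 4\<close>, but at
    \<open>x0\<close> it is at most \<open>5 * \<tau> / 4\<close>, so the minimum is
    interior.\<close>
  have "z \<in> ball y s"
  proof (rule ccontr)
    assume "z \<notin> ball y s"
    then have zs: "z \<in> sphere y s" using z(1) by auto
    have "m * \<psi> z \<le> 0" using m \<psi>(1)[OF z(1)] by (simp add: mult_nonpos_nonneg)
    then have "2 * \<tau> - \<tau> / 4 \<le> W z"
      using \<epsilon>1(2)[OF r(1,2) z(1)] \<tau>(2)[OF zs] unfolding W_def by linarith
    moreover have "W x0 \<le> \<tau> + \<tau> / 4"
      using \<epsilon>1(2)[OF r(1,2) x0(1)] ux0 unfolding W_def by linarith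
    ultimately show False using z(2)[OF x0(1)] \<tau>(1) by linarith
  qed
  then have d: "0 < s - dist y z" by simp
  define h where "h n = min 1 (s - dist y z) / Suc n" for n
  have h: "0 < h n" "h n \<le> 1" "h n \<le> s - dist y z" for n
  proof -
    show "0 < h n" using d by (simp add: h_def)
    have "h n \<le> min 1 (s - dist y z) / 1"
      unfolding h_def using d by (intro divide_left_mono) auto
    then show "h n \<le> 1" "h n \<le> s - dist y z" by auto
  qed
  have h0: "h \<longlonglongrightarrow> 0"
    unfolding h_def[abs_def] by (intro LIMSEQ_Suc lim_const_over_n)
  let ?b = "bump 0 z r"
  define J where "J = (\<integral>x. bump 0 0 r x \<partial>lebesgue)"
  have J: "0 < J" unfolding J_def using integral_bump_pos[OF r(1)] .
  define q where "q i = partial_deriv i (partial_deriv i ?b)" for i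
  \<comment> \<open>Second differences of \<open>W\<close> at its interior minimum are nonnegative,
    and those of \<open>\<psi>\<close> along an axis equal \<open>- (2 * E * (h n)\<^sup>2)\<close>.
    Dividing by the squared step and letting it tend to 0 gives the bound.\<close>
  have lower: "- (2 * E * m) * J \<le> (\<integral>x. u x * q i x \<partial>lebesgue)" for i
  proof -
    let ?e = "axis i 1 :: real^2"
    define I where "I n = (\<integral>x. u x * (?b (x + h n *\<^sub>R ?e) + ?b (x - h n *\<^sub>R ?e) - 2 * ?b x) \<partial>lebesgue)" for n
    have lim: "(\<lambda>n. I n / (h n)\<^sup>2) \<longlonglongrightarrow> (\<integral>x. u x * q i x \<partial>lebesgue)"
      unfolding I_def q_def
      by (rule tendsto_integral_second_difference[where z=z and R=r])
        (use u h h0 r(1) in \<open>auto simp: Ck_fun_bump bump_eq_0\<close>)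
    have "- (2 * E * m) * J \<le> I n / (h n)\<^sup>2" for n
    proof -
      have ne: "norm (h n *\<^sub>R ?e) \<le> s - dist y z" using h[of n] by simp
      have "z + h n *\<^sub>R ?e \<in> cball y s" "z - h n *\<^sub>R ?e \<in> cball y s"
        using ne dist_triangle[of y "z + h n *\<^sub>R ?e" z] dist_triangle[of y "z - h n *\<^sub>R ?e" z]
        by (simp_all add: dist_norm)
      then have "W z \<le> W (z + h n *\<^sub>R ?e)" "W z \<le> W (z - h n *\<^sub>R ?e)"
        using z(2) by blast+
      then have "2 * W z \<le> W (z + h n *\<^sub>R ?e) + W (z - h n *\<^sub>R ?e)" by linarith
      moreover have "\<psi> (z + h n *\<^sub>R ?e) + \<psi> (z - h n *\<^sub>R ?e) - 2 * \<psi> z = - (2 * E * (h n)\<^sup>2)"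
      proof -
        define a where "a = z - y"
        have a: "z + h n *\<^sub>R ?e - y = a + h n *\<^sub>R ?e" "z - h n *\<^sub>R ?e - y = a - h n *\<^sub>R ?e"
          by (simp_all add: a_def)
        have "?e \<bullet> ?e = 1" by (simp add: inner_axis)
        then show ?thesis
          unfolding \<psi>_def a a_def[symmetric]
          by (simp add: inner_add_left inner_add_right inner_diff_left inner_diff_right
              inner_commute algebra_simps power2_eq_square)
      qed
      moreover have "mollify r u (z + h n *\<^sub>R ?e) + mollify r u (z - h n *\<^sub>R ?e) - 2 * mollify r u z = I n / J"
        unfolding I_def J_def by (rule mollify_second_difference[OF u r(1)])
      moreover have "W (z + h n *\<^sub>R ?e) + W (z - h n *\<^sub>R ?e) - 2 * W z =
          (mollify r u (z + h n *\<^sub>R ?e) + mollify r u (z - h n *\<^sub>R ?e) - 2 * mollify r u z)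
          - m * (\<psi> (z + h n *\<^sub>R ?e) + \<psi> (z - h n *\<^sub>R ?e) - 2 * \<psi> z)"
        by (simp add: W_def algebra_simps)
      ultimately have "0 \<le> I n / J - m * - (2 * E * (h n)\<^sup>2)" by simp
      then have "- (2 * E * m) * (h n)\<^sup>2 \<le> I n / J" by (simp add: algebra_simps)
      then show ?thesis using J h(1)[of n] by (simp add: field_simps)
    qed
    then show ?thesis using lim by (intro LIMSEQ_le_const) auto
  qed
  have int: "integrable lebesgue (\<lambda>x. u x * q i x)" for i
  proof (rule integrable_continuous_compact_support[where S="cball z r"])
    have "continuous_on UNIV (q i)"
      using Ck_fun_bump[of 2 0 z r] by (simp add: q_def numeral_2_eq_2)
    then show "continuous_on UNIV (\<lambda>x. u x * q i x)" by (intro continuous_intros u)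
    have out: "open (- cball z r)" by auto
    have "bump 0 z r x = 0" if "x \<in> - cball z r" for x
      using that bump_eq_0[OF r(1)] by auto
    from partial_deriv_eq_0_open[OF out partial_deriv_eq_0_open[OF out this]]
    have "q i x = 0" if "x \<notin> cball z r" for x
      using that by (simp add: q_def)
    then show "u x * q i x = 0" if "x \<notin> cball z r" for x using that by simp
  qed simp
  have "(\<lambda>x. u x * laplacian ?b x) = (\<lambda>x. u x * q 1 x + u x * q 2 x)"
    by (simp add: laplacian_def q_def sum_2 distrib_left)
  \<comment> \<open>Adding the two axis directions produces the Laplacian of the bump, and the weak
    equation turns its integral into the mollification of \<open>v\<close>.\<close>
  then have "- (4 * E * m) * J \<le> (\<integral>x. u x * laplacian ?b x \<partial>lebesgue)"
    using lower[of 1] lower[of 2] int by simp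
  also have "\<dots> = J * mollify r v z"
    using eigenpair_bump[OF eig r(1)] J by (simp add: mollify_def J_def v_def)
  finally have "J * - (4 * E * m) \<le> J * mollify r v z" by (simp add: mult_ac)
  then have "- (4 * E * m) \<le> mollify r v z"
    by (simp only: mult_le_cancel_left_pos[OF J])
  also have "\<dots> \<le> v z - E * m / 2"
    using \<epsilon>2(2)[OF r(1,3) z(1)] by (simp add: abs_le_iff)
  \<comment> \<open>Here \<open>- u z \<le> - m * \<psi> z\<close> by the touching function, with
    \<open>\<psi> z \<le> 3\<close>. The gap between 4 and 3 exceeds the mollification error
    \<open>- E * m / 2\<close>, so the sign of \<open>m\<close> is contradicted.\<close>
  also have "v z \<le> - (3 * E * m)"
  proof -
    have "v z = (E - V z) * (- u z)" by (simp add: v_def algebra_simps)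
    also have "\<dots> \<le> (E - V z) * (- m * \<psi> z)"
      using V[OF z(1)] low[OF z(1)] \<tau>(1) by (intro mult_left_mono) auto
    also have "\<dots> \<le> E * (- m * 3)"
      using V[OF z(1)] \<psi>[OF z(1)] m s(2)
      by (intro mult_mono) (auto simp: mult_nonpos_nonneg)
    finally show ?thesis by simp
  qed
  finally have "0 \<le> E * m" by simp
  then show False using m s(2) by (simp add: zero_le_mult_iff)
qed

text \<open>A circle in the plane is connected, so a nonvanishing \<open>u\<close> has one sign on
  it; the preceding lemma for \<open>u\<close> or \<open>- u\<close> then excludes a zero at the
  centre. For \<open>s = 0\<close> the circle is the centre itself.\<close>

lemma eigenpair_zero_on_sphere:
  assumes eig: "eigenpair V u E" "continuous_on UNIV V"
    and s: "0 \<le> s" "0 < E" "E * s\<^sup>2 \<le> 1"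
    and V: "\<And>x. x \<in> cball y s \<Longrightarrow> 0 \<le> V x \<and> V x \<le> E"
    and "u y = 0"
  shows "\<exists>x\<in>sphere y s. u x = 0"
proof (cases "s = 0")
  case False
  show ?thesis
  proof (rule ccontr)
    assume *: "\<not> (\<exists>x\<in>sphere y s. u x = 0)"
    have u: "continuous_on (sphere y s) u"
      using eig(1) continuous_on_subset by (auto simp: eigenpair_def)
    then have C: "connected (u ` sphere y s)"
      by (intro connected_continuous_image connected_sphere) (auto simp: DIM_cart)
    have "(\<forall>x\<in>sphere y s. 0 < u x) \<or> (\<forall>x\<in>sphere y s. 0 < - u x)"
    proof (rule ccontr)
      assume "\<not> ?thesis"
      then obtain a b where "a \<in> sphere y s" "u a \<le> 0" "b \<in> sphere y s" "0 \<le> u b"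
        by (meson neg_0_less_iff_less not_less)
      then have "0 \<in> u ` sphere y s"
        using connectedD_interval[OF C, of "u a" "u b" 0] by blast
      then show False using * by auto
    qed
    then show False
      using eigenpair_pos_sphere_imp_pos_centre[OF eig _ s(2,3) V, of y]
        eigenpair_pos_sphere_imp_pos_centre[OF eigenpair_uminus[OF eig(1)] eig(2) _ s(2,3) V, of y]
        s(1) False assms(7) by force
  qed
qed (use assms in auto)

text \<open>Without zeros \<open>u\<close> would have one sign on the connected disc, which
  \<open>eigenpair_pos_ball_False\<close> excludes for both \<open>u\<close> and
  \<open>- u\<close>.\<close>

lemma eigenpair_zero_in_ball:
  assumes eig: "eigenpair V u E" "continuous_on UNIV V" and r: "0 < r"
    and V: "\<And>x. x \<in> ball z r \<Longrightarrow> V x + 324 / r\<^sup>2 < E"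
  shows "\<exists>x\<in>ball z r. u x = 0"
proof (rule ccontr)
  assume *: "\<not> (\<exists>x\<in>ball z r. u x = 0)"
  have u: "continuous_on (ball z r) u"
    using eig(1) continuous_on_subset by (auto simp: eigenpair_def)
  then have C: "connected (u ` ball z r)"
    by (intro connected_continuous_image connected_ball)
  have "(\<forall>x\<in>ball z r. 0 < u x) \<or> (\<forall>x\<in>ball z r. 0 < - u x)"
  proof (rule ccontr)
    assume "\<not> ?thesis"
    then obtain a b where "a \<in> ball z r" "u a \<le> 0" "b \<in> ball z r" "0 \<le> u b"
      by (meson neg_0_less_iff_less not_less)
    then have "0 \<in> u ` ball z r"
      using connectedD_interval[OF C, of "u a" "u b" 0] by blast
    then show False using * by auto
  qed
  then show False
    using eigenpair_pos_ball_False[OF eig r _ V, of z]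
      eigenpair_pos_ball_False[OF eigenpair_uminus[OF eig(1)] eig(2) r _ V, of z] by blast
qed

subsection \<open>Growth of the potential, Hausdorff measure and packing\<close>

text \<open>Since \<open>V \<ge> 1\<close>, the power of \<open>V\<close> in the gradient bound is
  at most \<open>V\<close>, so the gradient of \<open>ln V\<close> has norm at most
  \<open>C\<^sub>1\<close>. The mean value inequality bounds the growth of
  \<open>ln V\<close>.\<close>

lemma potential_exp_growth:
  assumes "admissible_potential \<rho>\<^sub>0 C\<^sub>1 Ac \<Lambda> V"
  shows "V y \<le> V x * exp (C\<^sub>1 * dist x y)"
proof -
  have V1: "1 \<le> V x" for x using assms by (simp add: admissible_potential_def)
  have diff: "V differentiable at x" for x
    using assms by (simp add: admissible_potential_def)
  have \<rho>: "0 < \<rho>\<^sub>0" "0 < C\<^sub>1" using assms by (auto simp: admissible_potential_def)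
  have grad: "norm (gradient V x) \<le> C\<^sub>1 * V x" for x
  proof -
    have "norm (gradient V x) \<le> C\<^sub>1 * V x powr (1 - \<rho>\<^sub>0)"
      using assms by (simp add: admissible_potential_def)
    also have "\<dots> \<le> C\<^sub>1 * V x powr 1"
      using \<rho> V1[of x] by (intro mult_left_mono powr_mono) auto
    also have "\<dots> = C\<^sub>1 * V x" using V1[of x] by simp
    finally show ?thesis .
  qed
  have D: "(V has_derivative (\<lambda>h. gradient V x \<bullet> h)) (at x)" for x
  proof -
    have lin: "linear (frechet_derivative V (at x))"
      by (rule linear_frechet_derivative[OF diff])
    have "frechet_derivative V (at x) h = gradient V x \<bullet> h" for h
    proof -
      have h: "h = (\<Sum>i\<in>UNIV. (h $ i) *\<^sub>R axis i 1)"
        using basis_expansion[of h] by (simp add: scalar_mult_eq_scaleR)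
      have "frechet_derivative V (at x) h = (\<Sum>i\<in>UNIV. (h $ i) *\<^sub>R frechet_derivative V (at x) (axis i 1))"
        by (subst h) (simp add: linear_sum[OF lin] linear_cmul[OF lin])
      then show ?thesis
        by (simp add: inner_vec_def gradient_def partial_deriv_def mult.commute)
    qed
    moreover have "(V has_derivative frechet_derivative V (at x)) (at x)"
      using diff frechet_derivative_works by blast
    ultimately show ?thesis by (metis (no_types, lifting) ext)
  qed
  have "((\<lambda>x. ln (V x)) has_derivative (\<lambda>h. (gradient V x \<bullet> h) / V x)) (at x)" for x
    using V1[of x] D[of x] by (auto intro!: derivative_eq_intros simp: divide_inverse)
  moreover have "onorm (\<lambda>h. (gradient V x \<bullet> h) / V x) \<le> C\<^sub>1" for x
  proof (rule onorm_bound)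
    fix h
    have "\<bar>gradient V x \<bullet> h\<bar> \<le> norm (gradient V x) * norm h"
      by (rule Cauchy_Schwarz_ineq2)
    also have "\<dots> \<le> (C\<^sub>1 * V x) * norm h" by (intro mult_right_mono grad) auto
    finally show "norm ((gradient V x \<bullet> h) / V x) \<le> C\<^sub>1 * norm h"
      using V1[of x] by (simp add: abs_divide divide_simps mult_ac)
  qed (use \<rho> in auto)
  ultimately have "norm (ln (V y) - ln (V x)) \<le> C\<^sub>1 * norm (y - x)"
    by (intro differentiable_bound[where S=UNIV]) auto
  then have "ln (V y) \<le> ln (V x) + C\<^sub>1 * dist x y"
    by (simp add: dist_norm norm_minus_commute abs_le_iff)
  then have "exp (ln (V y)) \<le> exp (ln (V x) + C\<^sub>1 * dist x y)" by simp
  then show ?thesis using V1[of x] V1[of y] by (simp add: exp_add)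
qed

text \<open>The distance from \<open>c\<close> is 1-Lipschitz, so it maps each \<open>U n\<close>
  into an interval no longer than the diameter of \<open>U n\<close>. These intervals cover
  \<open>{0..a}\<close>, and countable subadditivity of length applies.\<close>

lemma diameter_sum_ge_radius:
  fixes U :: "nat \<Rightarrow> 'a::metric_space set"
  assumes "\<And>s. 0 \<le> s \<Longrightarrow> s \<le> a \<Longrightarrow> \<exists>x\<in>\<Union>n. U n. dist c x = s"
    and bdd: "\<And>n. bounded (U n)"
  shows "ennreal a \<le> (\<Sum>n. ennreal (diameter (U n)))"
proof -
  define D where "D n = dist c ` U n" for n
  \<comment> \<open>The empty set is treated apart because \<open>Inf\<close> and \<open>Sup\<close>
    carry no information there.\<close>
  define F where "F n = (if U n = {} then {} else {Inf (D n)..Sup (D n)})" for n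
  have bD: "bdd_above (D n)" "bdd_below (D n)" for n
  proof -
    obtain e where "\<And>x. x \<in> U n \<Longrightarrow> dist c x \<le> e"
      using bdd[of n] bounded_any_center[of "U n" c] by auto
    then show "bdd_above (D n)" unfolding D_def by (rule bdd_aboveI2)
    show "bdd_below (D n)" unfolding D_def by (rule bdd_belowI2[of _ 0]) simp
  qed
  have len: "emeasure lborel (F n) \<le> ennreal (diameter (U n))" for n
  proof (cases "U n = {}")
    case False
    have "p - diameter (U n) \<le> q" if "p \<in> D n" "q \<in> D n" for p q
    proof -
      obtain x where x: "x \<in> U n" "p = dist c x"
        using \<open>p \<in> D n\<close> by (auto simp: D_def)
      obtain x' where x': "x' \<in> U n" "q = dist c x'"
        using \<open>q \<in> D n\<close> by (auto simp: D_def)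
      have "dist x x' \<le> diameter (U n)"
        by (rule diameter_bounded_bound[OF bdd x(1) x'(1)])
      then show ?thesis using dist_triangle[of c x x'] x(2) x'(2) by (simp add: dist_commute)
    qed
    then have "p - diameter (U n) \<le> Inf (D n)" if "p \<in> D n" for p
      using that False by (intro cInf_greatest) (auto simp: D_def)
    then have "Sup (D n) \<le> Inf (D n) + diameter (U n)"
      using False by (intro cSup_least) (auto simp: D_def algebra_simps)
    moreover have "Inf (D n) \<le> Sup (D n)"
      using False bD by (intro cInf_le_cSup) (auto simp: D_def)
    ultimately show ?thesis using False by (simp add: F_def ennreal_leI)
  qed (simp add: F_def)
  have "{0..a} \<subseteq> (\<Union>n. F n)"
  proof
    fix s assume "s \<in> {0..a}"
    then obtain n x where x: "x \<in> U n" "dist c x = s" using assms(1)[of s] by auto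
    then have "s \<in> D n" by (auto simp: D_def)
    then have "s \<in> {Inf (D n)..Sup (D n)}"
      using bD by (auto intro: cInf_lower cSup_upper)
    then show "s \<in> (\<Union>n. F n)" using x by (auto simp: F_def)
  qed
  then have "emeasure lborel {0..a} \<le> emeasure lborel (\<Union>n. F n)"
    by (intro emeasure_mono) (auto simp: F_def)
  also have "\<dots> \<le> (\<Sum>n. emeasure lborel (F n))"
    by (intro emeasure_subadditive_countably) (auto simp: F_def)
  also have "\<dots> \<le> (\<Sum>n. ennreal (diameter (U n)))"
    by (intro suminf_le len) auto
  finally show ?thesis
    by (cases "0 \<le> a") (auto simp: ennreal_neg)
qed

text \<open>
  The map \<open>x \<mapsto> dist (c i) x\<close> is 1-Lipschitz and maps the part of \<open>S\<close> near \<open>c i\<close> onto \<open>[0, a]\<close>;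
  covering sets of diameter at most \<open>b / 2\<close> meet only one of these parts.
\<close>

lemma hausdorff1_ge_card:
  fixes S :: "'a::metric_space set" and c :: "'i \<Rightarrow> 'a"
  assumes "finite I" "0 < b"
    and S: "\<And>i s. i \<in> I \<Longrightarrow> 0 \<le> s \<Longrightarrow> s \<le> a \<Longrightarrow> \<exists>x\<in>S. dist (c i) x = s"
    and sep: "\<And>i j. i \<in> I \<Longrightarrow> j \<in> I \<Longrightarrow> i \<noteq> j \<Longrightarrow> 2 * a + b \<le> dist (c i) (c j)"
  shows "of_nat (card I) * ennreal a \<le> hausdorff1 S"
proof -
  \<comment> \<open>One scale suffices, as \<open>hausdorff1\<close> is a supremum over scales. A
    set of diameter \<open>b / 2\<close> meeting two of the discs would put their centres within
    \<open>2 * a + b / 2\<close>.\<close>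
  have "of_nat (card I) * ennreal a \<le> hausdorff1_pre (b / 2) S"
    unfolding hausdorff1_pre_def
  proof (rule INF_greatest)
    fix U assume "U \<in> {U :: nat \<Rightarrow> 'a set. S \<subseteq> (\<Union>n. U n) \<and> (\<forall>n. bounded (U n) \<and> diameter (U n) \<le> b / 2)}"
    then have U: "S \<subseteq> (\<Union>n. U n)" "\<And>n. bounded (U n)" "\<And>n. diameter (U n) \<le> b / 2" by auto
    define P where "P i n = U n \<inter> cball (c i) a" for i n
    have bP: "bounded (P i n)" for i n
      using U(2)[of n] by (auto simp: P_def intro: bounded_subset)
    have "of_nat (card I) * ennreal a = (\<Sum>i\<in>I. ennreal a)" by simp
    also have "\<dots> \<le> (\<Sum>i\<in>I. \<Sum>n. ennreal (diameter (P i n)))"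
    proof (intro sum_mono diameter_sum_ge_radius bP)
      fix i s assume i: "i \<in> I" and s: "0 \<le> s" "s \<le> a"
      then obtain x where "x \<in> S" "dist (c i) x = s" using S by blast
      then show "\<exists>x\<in>\<Union>n. P i n. dist (c i) x = s"
        using U(1) s by (auto simp: P_def intro!: bexI[of _ x])
    qed
    also have "\<dots> = (\<Sum>n. \<Sum>i\<in>I. ennreal (diameter (P i n)))"
      by (intro suminf_sum[symmetric] summableI)
    also have "\<dots> \<le> (\<Sum>n. ennreal (diameter (U n)))"
    proof (intro suminf_le summableI)
      fix n
      show "(\<Sum>i\<in>I. ennreal (diameter (P i n))) \<le> ennreal (diameter (U n))"
      proof (cases "\<exists>i\<in>I. P i n \<noteq> {}")
        case True
        then obtain i where i: "i \<in> I" "P i n \<noteq> {}" by blast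
        have "P j n = {}" if "j \<in> I" "j \<noteq> i" for j
        proof (rule ccontr)
          assume "P j n \<noteq> {}"
          with i obtain x x' where x: "x \<in> U n" "dist (c i) x \<le> a" "x' \<in> U n" "dist (c j) x' \<le> a"
            by (auto simp: P_def)
          have "dist x x' \<le> b / 2"
            using diameter_bounded_bound[OF U(2) x(1,3)] U(3)[of n] by linarith
          moreover have "dist (c i) (c j) \<le> dist (c i) x + dist x x' + dist (c j) x'"
            using dist_triangle[of "c i" "c j" x] dist_triangle[of x "c j" x'] by (simp add: dist_commute)
          ultimately show False using sep[OF i(1) that(1)] that(2) x(2,4) assms(2) by auto
        qed
        then have "(\<Sum>i\<in>I. ennreal (diameter (P i n))) = (\<Sum>j\<in>{i}. ennreal (diameter (P j n)))"
          using i(1) assms(1) by (intro sum.mono_neutral_right) auto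
        also have "\<dots> \<le> ennreal (diameter (U n))"
          by (auto intro!: ennreal_leI diameter_subset U(2) simp: P_def)
        finally show ?thesis .
      qed simp
    qed
    finally show "of_nat (card I) * ennreal a \<le> (\<Sum>n. ennreal (diameter (U n)))" .
  qed
  also have "\<dots> \<le> hausdorff1 S"
    unfolding hausdorff1_def using assms(2) by (intro SUP_upper) auto
  finally show ?thesis .
qed

text \<open>Compactness of the closure gives a finite cover by discs of radius \<open>\<rho>\<close>
  centred in \<open>S\<close>. Vitali selection keeps disjoint ones whose fivefold enlargements
  still cover, hence the factor 25.\<close>

lemma disjoint_balls_packing:
  fixes S :: "(real^2) set"
  assumes "bounded S" "S \<in> sets lebesgue" "0 < \<rho>"
  obtains C where "finite C" "C \<subseteq> S"
    "\<And>x x'. x \<in> C \<Longrightarrow> x' \<in> C \<Longrightarrow> x \<noteq> x' \<Longrightarrow> 2 * \<rho> < dist x x'"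
    "area S \<le> card C * (25 * pi * \<rho>\<^sup>2)"
proof -
  have "closure S \<subseteq> (\<Union>x\<in>S. ball x \<rho>)"
    using assms(3) by (auto simp: closure_approachable dist_commute)
  then obtain K where K: "K \<subseteq> S" "finite K" "closure S \<subseteq> (\<Union>x\<in>K. ball x \<rho>)"
    using compactE_image[of "closure S" S "\<lambda>x. ball x \<rho>"] assms(1) by (auto simp: compact_closure)
  have cover: "S \<subseteq> (\<Union>x\<in>K. cball x \<rho>)"
  proof
    fix x assume "x \<in> S"
    then have "x \<in> closure S" using closure_subset by blast
    then obtain k where "k \<in> K" "x \<in> ball k \<rho>" using K(3) by blast
    moreover from this have "x \<in> cball k \<rho>" by simp
    ultimately show "x \<in> (\<Union>x\<in>K. cball x \<rho>)" by blast
  qed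
  obtain C where C: "C \<subseteq> K"
     "pairwise (\<lambda>i j. disjnt (cball i \<rho>) (cball j \<rho>)) C" "S \<subseteq> (\<Union>i\<in>C. cball i (5 * \<rho>))"
    by (rule Vitali_covering_lemma_cballs[where a="\<lambda>x. x" and r="\<lambda>x. \<rho>" and B=\<rho>, OF cover])
      (simp add: assms(3), blast)
  have fin: "finite C" using C(1) K(2) finite_subset by blast
  show thesis
  proof (rule that[OF fin])
    show "C \<subseteq> S" using C(1) K(1) by blast
    show "2 * \<rho> < dist x x'" if "x \<in> C" "x' \<in> C" "x \<noteq> x'" for x x'
    proof -
      have "disjnt (cball x \<rho>) (cball x' \<rho>)" using C(2) that by (auto simp: pairwise_def)
      \<comment> \<open>Centres at distance at most \<open>2 * \<rho>\<close> would have their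
        midpoint in both discs.\<close>
      then have "midpoint x x' \<notin> cball x \<rho> \<inter> cball x' \<rho>" by (auto simp: disjnt_def)
      then show ?thesis by (auto simp: dist_midpoint)
    qed
    have "area S \<le> measure lebesgue (\<Union>i\<in>C. cball i (5 * \<rho>))"
      unfolding area_def using C(3) assms(2) fin
      by (intro measure_mono_fmeasurable fmeasurable.finite_UN) auto
    also have "\<dots> \<le> (\<Sum>i\<in>C. measure lebesgue (cball i (5 * \<rho>)))"
      by (intro measure_UNION_le fin) auto
    also have "\<dots> = card C * (25 * pi * \<rho>\<^sup>2)"
      using assms(3) by (simp add: content_cball unit_ball_vol_2 power_mult_distrib mult_ac)
    finally show "area S \<le> card C * (25 * pi * \<rho>\<^sup>2)" .
  qed
qed

subsection \<open>The length of the nodal set\<close>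

theorem proposition7p8:
  fixes \<delta> \<rho>\<^sub>0 C\<^sub>1 :: real and Ac \<Lambda> :: "real \<Rightarrow> real"
  assumes "0 < \<delta>" and "\<delta> < 1"
  shows "\<exists>C>0. \<forall>V. admissible_potential \<rho>\<^sub>0 C\<^sub>1 Ac \<Lambda> V \<longrightarrow>
           (\<exists>E\<^sub>0. \<forall>u E. eigenpair V u E \<and> E\<^sub>0 \<le> E \<longrightarrow>
              ennreal (C * E powr (1/2) * area (sublevel V E))
                < hausdorff1 (nodal_set u \<inter> sublevel V (\<delta> * E)))"
proof -
  \<comment> \<open>On a disc of radius \<open>M / sqrt E\<close> the bump costs
    \<open>324 / 325 * (1 - \<delta>) * E\<close>, strictly less than the gap
    \<open>(1 - \<delta>) * E\<close> between \<open>\<delta> * E\<close> and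
    \<open>E\<close>.\<close>
  define M where "M = sqrt (325 / (1 - \<delta>))"
  have M: "0 < M" "M\<^sup>2 = 325 / (1 - \<delta>)" using assms by (simp_all add: M_def)
  \<comment> \<open>As the constant is chosen before \<open>V\<close>, the sign of
    \<open>Ac (\<delta>/2)\<close> is not yet known; the absolute value plus 1 is positive and
    strictly larger.\<close>
  define A where "A = \<bar>Ac (\<delta>/2)\<bar> + 1"
  \<comment> \<open>Chosen to cancel the packing constant, the doubling constant and
    \<open>(M + 2)\<^sup>2\<close>, so that the final estimate reduces to
    \<open>card P * a\<close>.\<close>
  define C where "C = 1 / (25 * pi * (M + 2)\<^sup>2 * A)"
  have A: "0 < A" by (simp add: A_def)
  have C: "0 < C" using A M(1) by (simp add: C_def)
  show ?thesis
  proof (rule exI[of _ C], intro conjI C allI impI)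
    fix V assume adm: "admissible_potential \<rho>\<^sub>0 C\<^sub>1 Ac \<Lambda> V"
    have C1: "0 < C\<^sub>1" and V1: "\<And>x. 1 \<le> V x" and V_inf: "filterlim V at_top at_infinity"
      using adm by (auto simp: admissible_potential_def)
    have "Ck_fun 0 V"
      using adm Ck_fun_Suc_imp[of 0 V] by (simp add: admissible_potential_def)
    then have V: "continuous_on UNIV V" by simp
    \<comment> \<open>The first bound makes the doubling condition available for
      \<open>\<delta>/2\<close>; the second gives \<open>C\<^sub>1 * \<rho> \<le> ln 2\<close>, so
      that \<open>V\<close> at most doubles over distance \<open>\<rho>\<close>.\<close>
    define E0 where "E0 = max (max 1 (\<Lambda> (\<delta>/2))) ((C\<^sub>1 * (M + 2) / ln 2)\<^sup>2)"
    show "\<exists>E\<^sub>0. \<forall>u E. eigenpair V u E \<and> E\<^sub>0 \<le> E \<longrightarrow>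
      ennreal (C * E powr (1/2) * area (sublevel V E)) < hausdorff1 (nodal_set u \<inter> sublevel V (\<delta> * E))"
    proof (intro exI[of _ E0] allI impI)
      fix u E assume "eigenpair V u E \<and> E0 \<le> E"
      then have eig: "eigenpair V u E" and E: "1 \<le> E" "\<Lambda> (\<delta>/2) \<le> E" "(C\<^sub>1 * (M + 2) / ln 2)\<^sup>2 \<le> E"
        by (auto simp: E0_def)
      define a where "a = 1 / sqrt E"
      have a: "0 < a" "a\<^sup>2 = 1 / E" using E(1) by (simp_all add: a_def power_divide)
      \<comment> \<open>The radius allows \<open>M * a\<close> for reaching a zero and
        \<open>a\<close> for the circles around it; the remaining \<open>a\<close> keeps different
        families of circles apart.\<close>
      define \<rho> where "\<rho> = (M + 2) * a"
      have \<rho>: "0 < \<rho>" using M(1) a(1) by (simp add: \<rho>_def)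
      have "C\<^sub>1 * (M + 2) / ln 2 \<le> sqrt E"
        using E(3) by (intro real_le_rsqrt)
      then have C1\<rho>: "C\<^sub>1 * \<rho> \<le> ln 2"
        using E(1) by (simp add: \<rho>_def a_def field_simps)
      have grow: "V y < \<delta> * E" if "V x < \<delta> / 2 * E" "dist x y \<le> \<rho>" for x y
      proof -
        have "C\<^sub>1 * dist x y \<le> ln 2"
          using mult_left_mono[OF that(2), of C\<^sub>1] C1 C1\<rho> by linarith
        then have "exp (C\<^sub>1 * dist x y) \<le> exp (ln 2)" by (subst exp_le_cancel_iff)
        then have "V x * exp (C\<^sub>1 * dist x y) \<le> V x * 2"
          using V1[of x] by (intro mult_left_mono) auto
        then show ?thesis using potential_exp_growth[OF adm, of y x] that(1) by linarith
      qed
      define S where "S = sublevel V (\<delta> / 2 * E)"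
      have "\<forall>\<^sub>F x in at_infinity. \<delta> / 2 * E \<le> V x"
        using V_inf unfolding filterlim_at_top by blast
      then obtain b where "\<And>x. b \<le> norm x \<Longrightarrow> \<delta> / 2 * E \<le> V x"
        by (auto simp: eventually_at_infinity)
      then have "S \<subseteq> cball 0 b"
        unfolding S_def sublevel_def by (smt (verit) mem_Collect_eq mem_cball_0 subsetI)
      then have S_bdd: "bounded S" using bounded_cball bounded_subset by blast
      have "open S"
        unfolding S_def sublevel_def using V by (intro open_Collect_less continuous_on_const) auto
      then have S_meas: "S \<in> sets lebesgue" by auto
      have ratio: "1 < area (sublevel V E) / area S" "area (sublevel V E) / area S \<le> Ac (\<delta>/2)"
      proof -
        have "\<forall>\<delta>. 0 < \<delta> \<and> \<delta> < 1 \<longrightarrow>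
          (\<forall>t \<ge> \<Lambda> \<delta>. 1 < area (sublevel V t) / area (sublevel V (\<delta> * t)) \<and>
                      area (sublevel V t) / area (sublevel V (\<delta> * t)) \<le> Ac \<delta>)"
          using adm unfolding admissible_potential_def by blast
        from this[rule_format, of "\<delta>/2" E] assms E(2)
        show "1 < area (sublevel V E) / area S" "area (sublevel V E) / area S \<le> Ac (\<delta>/2)"
          by (simp_all add: S_def)
      qed
      \<comment> \<open>Division by zero yields 0, so a ratio above 1 excludes zero area.\<close>
      have S_pos: "0 < area S"
        using ratio(1) by (cases "area S = 0") (auto simp: area_def less_le)
      have "area (sublevel V E) / area S < A" using ratio(2) by (simp add: A_def)
      then have S_big: "area (sublevel V E) < A * area S" using S_pos by (simp add: divide_simps)
      obtain P where P: "finite P" "P \<subseteq> S"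
        "\<And>x x'. x \<in> P \<Longrightarrow> x' \<in> P \<Longrightarrow> x \<noteq> x' \<Longrightarrow> 2 * \<rho> < dist x x'"
        "area S \<le> card P * (25 * pi * \<rho>\<^sup>2)"
        using disjoint_balls_packing[OF S_bdd S_meas \<rho>] by blast
      have "\<exists>y\<in>ball x (M * a). u y = 0" if "x \<in> P" for x
      proof (rule eigenpair_zero_in_ball[OF eig V])
        show "0 < M * a" using M(1) a(1) by simp
        fix y assume y: "y \<in> ball x (M * a)"
        have "M * a \<le> \<rho>" using a(1) by (simp add: \<rho>_def algebra_simps)
        then have "V y < \<delta> * E"
          using y that P(2) by (intro grow[of x]) (auto simp: S_def sublevel_def)
        moreover have "324 / (M * a)\<^sup>2 = 324 / 325 * ((1 - \<delta>) * E)"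
          using assms by (simp add: power_mult_distrib M(2) a(2))
        moreover have "0 < (1 - \<delta>) * E" using assms E(1) by simp
        ultimately show "V y + 324 / (M * a)\<^sup>2 < E" by (simp add: algebra_simps)
      qed
      then obtain c where c: "\<And>x. x \<in> P \<Longrightarrow> c x \<in> ball x (M * a)" "\<And>x. x \<in> P \<Longrightarrow> u (c x) = 0"
        by metis
      have circle: "\<exists>p\<in>nodal_set u \<inter> sublevel V (\<delta> * E). dist (c x) p = s"
        if x: "x \<in> P" and s: "0 \<le> s" "s \<le> a" for x s
      proof -
        have small: "V p < \<delta> * E" if "p \<in> cball (c x) s" for p
        proof -
          have "dist x p \<le> M * a + a"
            using c(1)[OF x] that s(2) dist_triangle[of x p "c x"] by auto
          also have "\<dots> \<le> \<rho>" using a(1) by (simp add: \<rho>_def algebra_simps)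
          finally show ?thesis
            using x P(2) by (intro grow[of x]) (auto simp: S_def sublevel_def)
        qed
        have "E * s\<^sup>2 \<le> E * a\<^sup>2" using s E(1) by (intro mult_left_mono power_mono) auto
        also have "\<dots> = 1" using E(1) by (simp add: a(2))
        finally have "E * s\<^sup>2 \<le> 1" .
        moreover have "0 \<le> V p \<and> V p \<le> E" if "p \<in> cball (c x) s" for p
        proof -
          have "\<delta> * E \<le> 1 * E" using assms E(1) by (intro mult_right_mono) auto
          then show ?thesis using small[OF that] V1[of p] by (intro conjI) linarith+
        qed
        moreover have "0 < E" using E(1) by simp
        ultimately have "\<exists>p\<in>sphere (c x) s. u p = 0"
          using c(2)[OF x] by (intro eigenpair_zero_on_sphere[OF eig V s(1)])
        then obtain p where p: "p \<in> sphere (c x) s" "u p = 0" by blast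
        have "p \<in> nodal_set u"
          unfolding nodal_set_def using p(2) closure_subset[of "{x. u x = 0}"] by blast
        moreover have "p \<in> sublevel V (\<delta> * E)"
          using small[of p] p(1) by (simp add: sublevel_def)
        ultimately show ?thesis using p(1) by auto
      qed
      \<comment> \<open>Moving both centres by less than \<open>M * a\<close> leaves more than
        \<open>2 * \<rho> - 2 * M * a = 4 * a\<close>, the separation needed with
        \<open>b = 2 * a\<close>.\<close>
      have sep: "2 * a + 2 * a \<le> dist (c x) (c x')" if "x \<in> P" "x' \<in> P" "x \<noteq> x'" for x x'
      proof -
        have "dist x x' \<le> dist x (c x) + dist (c x) (c x') + dist x' (c x')"
          using dist_triangle[of x x' "c x"] dist_triangle[of "c x" x' "c x'"] by (simp add: dist_commute)
        then show ?thesis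
          using P(3)[OF that] c(1)[OF that(1)] c(1)[OF that(2)] by (simp add: \<rho>_def algebra_simps)
      qed
      have Ea: "E powr (1/2) = E * a"
        using E(1) by (simp add: powr_half_sqrt a_def real_div_sqrt)
      \<comment> \<open>Strictness enters here, through the strict bound by \<open>A\<close> on the
        area ratio; the packing estimate and the choice of \<open>C\<close> do the rest.\<close>
      have "C * (E * a) * area (sublevel V E) < C * (E * a) * (A * area S)"
        using C E(1) a(1) S_big by (intro mult_strict_left_mono) auto
      also have "\<dots> \<le> C * (E * a) * (A * (card P * (25 * pi * \<rho>\<^sup>2)))"
        using C E(1) a(1) A P(4) by (intro mult_left_mono) auto
      also have "\<dots> = card P * a"
        using M(1) A E(1) by (simp add: C_def \<rho>_def power_mult_distrib a(2))
      finally have lt: "C * (E * a) * area (sublevel V E) < card P * a" .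
      moreover have "0 \<le> C * (E * a) * area (sublevel V E)"
        using C E(1) a(1) by (simp add: area_def)
      ultimately have "0 < card P * a" by linarith
      then have "ennreal (C * E powr (1/2) * area (sublevel V E)) < ennreal (card P * a)"
        unfolding Ea using lt by (rule ennreal_lessI)
      also have "\<dots> = of_nat (card P) * ennreal a"
        using a(1) by (simp add: ennreal_mult ennreal_of_nat_eq_real_of_nat)
      also have "\<dots> \<le> hausdorff1 (nodal_set u \<inter> sublevel V (\<delta> * E))"
        by (rule hausdorff1_ge_card[OF P(1), of "2 * a" a]) (use a(1) circle sep in auto)
      finally show "ennreal (C * E powr (1/2) * area (sublevel V E))
        < hausdorff1 (nodal_set u \<inter> sublevel V (\<delta> * E))" .
    qed
  qed
qed

end
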